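(* Let $(x,\sigma)$ be a forward complete trajectory of $\dot x=f(x,\sigma)$ with $\sigma\in\mathcal{S}_a$. For a function $V\in\mathcal{V}$ and a family of functions $\{W_\gamma:\mathcal{O}_\gamma\to\mathbb{R},\ \gamma\in\Gamma\}$ consider the inequality $$(\ast)\qquad -\nabla V_\gamma(\xi)f_\gamma(\xi)\ge W_\gamma(\xi)\ge0\qquad\forall\xi\in\mathcal{O}_\gamma,\ \forall\gamma\in\Gamma.$$ Then the following holds. 1. Suppose there exist $V\in\mathcal{V}$, whose restriction to $\mathrm{dom}(f)\cap(\mathcal{O}\times\Gamma)$ is continuous, and a family $\{W_\gamma:\mathcal{O}_\gamma\to\mathbb{R},\gamma\in\Gamma\}$ such that $(x,\sigma)$ is precompact relative to $\mathcal{O}$, $v(t)=V(x(t),\sigma(t))$ is nonincreasing on $[0,+\infty)$ and $(\ast)$ holds. Then there exists $c\in\mathbb{R}$ such that $$x\to\bigcup_{\gamma,\gamma'\in\Gamma}\left(\mathcal{O}_\gamma^f(f_\gamma,W_\gamma)\cap\mathcal{O}_{\gamma'}^b(f_{\gamma'},W_{\gamma'})\cap V_\gamma^{-1}(c)\cap V_{\gamma'}^{-1}(c)\right).$$ 2. Suppose there exist $V\in\mathcal{V}$, which is bounded on compact subsets of $\mathrm{dom}(f)\cap(\mathcal{O}\times\Gamma)$, and a family $\{W_\gamma:\mathcal{O}_\gamma\to\mathbb{R},\gamma\in\Gamma\}$ such that $(x,\sigma)$ is precompact relative to $\mathcal{O}$, $v(t)=V(x(t),\sigma(t))$ is nonincreasing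 on $[0,+\infty)$, $(\ast)$ holds, and $W(\xi,\gamma):=W_\gamma(\xi)$ is continuous on $\mathrm{dom}(W)=\mathrm{dom}(f)\cap(\mathcal{O}\times\Gamma)$. Then $$x\to\bigcup_{\gamma,\gamma'\in\Gamma}\left(\mathcal{O}_\gamma^f(f_\gamma,W_\gamma)\cap\mathcal{O}_{\gamma'}^b(f_{\gamma'},W_{\gamma'})\right).$$ 3. Suppose $\Gamma=\{1,\ldots,N\}$ is finite and there exist $V\in\mathcal{V}$ and a family $\{W_\gamma:\mathcal{O}_\gamma\to\mathbb{R},\gamma\in\Gamma\}$ such that $(x,\sigma)$ is precompact relative to $\mathcal{O}$, for every $\gamma\in\Gamma$ the function $v(t)=V(x(t),\sigma(t))$ is nonincreasing on $\sigma^{-1}(\gamma)\cap[0,+\infty)$, and $(\ast)$ holds. Then there exists $\vec c=(c_1,\ldots,c_N)\in\mathbb{R}^N$ such that $$x\to\bigcup_{\gamma,\gamma'\in\Gamma}\left(\mathcal{O}_\gamma^f(f_\gamma,W_\gamma)\cap\mathcal{O}_{\gamma'}^b(f_{\gamma'},W_{\gamma'})\cap V_\gamma^{-1}(c_\gamma)\cap V_{\gamma'}^{-1}(c_{\gamma'})\right).$$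
   Context: Setting: $\Gamma$ is a compact metric space, $\mathrm{dom}(f)\subset\mathbb{R}^n\times\Gamma$ is closed and $f:\mathrm{dom}(f)\to\mathbb{R}^n$ is continuous. For $\gamma\in\Gamma$, $\chi_\gamma=\{\xi\in\mathbb{R}^n:(\xi,\gamma)\in\mathrm{dom}(f)\}$ and $f_\gamma:\chi_\gamma\to\mathbb{R}^n$, $f_\gamma(\xi)=f(\xi,\gamma)$. A switching signal is a function $\sigma:\mathbb{R}\to\Gamma$ that is piecewise constant (at most finitely many jumps in each compact interval) and continuous from the right; $\Lambda(\sigma)$ is the set of times at which $\sigma$ has a jump. A solution of $\dot x=f(x,\sigma)$ corresponding to $\sigma$ is a locally absolutely continuous $x:I_x\to\mathbb{R}^n$, $I_x\subset\mathbb{R}$ a nonempty interval, with $(x(t),\sigma(t))\in\mathrm{dom}(f)$ for all $t\in I_x$ and $\dot x(t)=f(x(t),\sigma(t))$ for almost all $t\in I_x$. Then $(x,\sigma)$ is called a trajectory; it is forward complete if $\mathbb{R}_{\ge0}\subset I_x$. It is precompact relative to $\mathcal{O}\subset\mathbb{R}^n$ if there is a compact set $B\subset\mathcal{O}$ with $x(t)\in B$ for all $t\in I_x$. $\mathcal{S}_a=\bigcup_{\tau_D>0,N_0\in\mathbb{N}}\mathcal{S}_a[\tau_D,N_0]$, where $\mathcal{S}_a[\tau_D,N_0]$ is the set of switching signals $\sigma$ with $\mathrm{card}(\Lambda(\sigma)\cap(\tau_1,\tau_2))\le N_0+(\tau_2-\tau_1)/\tau_D$ for every finite open interval $(\tau_1,\tau_2)$.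 For $M\subset\mathbb{R}^n$, $x\to M$ means $\lim_{t\to+\infty}d(x(t),M)=0$, where $d(\xi,M)=\inf_{\nu\in M}|\nu-\xi|$. $\pi_1:\mathbb{R}^n\times\Gamma\to\mathbb{R}^n$ is the projection onto the first component. Class $\mathcal{V}$: $V:\mathrm{dom}(V)\to\mathbb{R}$ belongs to $\mathcal{V}$ if $\mathrm{dom}(V)\subset\mathbb{R}^n\times\Gamma$; for every $\gamma\in\Gamma$ the set $\mathcal{D}_\gamma=\{\xi:(\xi,\gamma)\in\mathrm{dom}(V)\}$ is open; with $\mathcal{O}=\pi_1(\mathrm{dom}(V))$ and $\mathcal{O}_\gamma=\mathcal{O}\cap\chi_\gamma$, one has $\mathcal{O}_\gamma\subset\mathcal{D}_\gamma$ for all $\gamma$; and for all $\gamma$, $V_\gamma(\cdot)=V(\cdot,\gamma)$ is differentiable on $\mathcal{O}_\gamma$. ($\mathcal{O}$ and $\mathcal{O}_\gamma$ always refer to the function $V$ under consideration.) Observability-like sets: given $\mathcal{X}\subset\mathbb{R}^n$, a continuous map $g:\mathcal{X}\to\mathbb{R}^n$, a function $h:\mathcal{X}\to\mathbb{R}$ and $\tau>0$ or $\tau=\infty$, $\mathcal{X}^f(g,h,\tau)$ (resp. $\mathcal{X}^b(g,h,\tau)$) is the set of $\xi\in\mathcal{X}$ for which there is a solution $\varphi:[0,\tau]\to\mathcal{X}$ (resp. $\varphi:[-\tau,0]\to\mathcal{X}$) of $\dot x=g(x)$ with $\varphi(0)=\xi$ and $h(\varphi(t))=0$ for all $t\in[0,\tau]$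 (resp. $t\in[-\tau,0]$) (half-lines when $\tau=\infty$). Also $\mathcal{X}^f(g,h)=\bigcup_{\tau>0}\mathcal{X}^f(g,h,\tau)$ and $\mathcal{X}^b(g,h)=\bigcup_{\tau>0}\mathcal{X}^b(g,h,\tau)$. The sets $\mathcal{O}_\gamma^f(f_\gamma,W_\gamma)$, $\mathcal{O}_\gamma^b(f_\gamma,W_\gamma)$ are these sets with $\mathcal{X}=\mathcal{O}_\gamma$, $g=f_\gamma|_{\mathcal{O}_\gamma}$, $h=W_\gamma$. *)

theory Defs
  imports "HOL-Analysis.Analysis"
begin

text \<open>
  The parameter space is a subset \<open>\<Gamma>\<close> of a metric space type; partial maps are total HOL functions
  together with an explicit domain \<open>domf\<close>, \<open>domV\<close>, outside of which their values are irrelevant.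
\<close>

definition fiber :: "('a \<times> 'g) set \<Rightarrow> 'g \<Rightarrow> 'a set" where
  "fiber D \<gamma> = {\<xi>. (\<xi>, \<gamma>) \<in> D}"

subsection \<open>Switching signals\<close>

text \<open>For a piecewise constant signal the jump times are exactly the points of discontinuity.\<close>

definition jump_times :: "(real \<Rightarrow> 'g::metric_space) \<Rightarrow> real set" where
  "jump_times \<sigma> = {t. \<not> isCont \<sigma> t}"

definition switching_signal :: "'g::metric_space set \<Rightarrow> (real \<Rightarrow> 'g) \<Rightarrow> bool" where
  "switching_signal \<Gamma> \<sigma> \<longleftrightarrow>
     range \<sigma> \<subseteq> \<Gamma> \<and>
     (\<forall>a b. finite (jump_times \<sigma> \<inter> {a..b})) \<and>
     (\<forall>a b. jump_times \<sigma> \<inter> {a<..<b} = {} \<longrightarrow> \<sigma> constant_on {a<..<b}) \<and>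
     (\<forall>t. continuous (at_right t) \<sigma>)"

definition signals_avg_dwell_with :: "'g::metric_space set \<Rightarrow> real \<Rightarrow> nat \<Rightarrow> (real \<Rightarrow> 'g) set" where
  "signals_avg_dwell_with \<Gamma> \<tau>\<^sub>D N\<^sub>0 =
     {\<sigma>. switching_signal \<Gamma> \<sigma> \<and>
         (\<forall>\<tau>\<^sub>1 \<tau>\<^sub>2. \<tau>\<^sub>1 < \<tau>\<^sub>2 \<longrightarrow>
            real (card (jump_times \<sigma> \<inter> {\<tau>\<^sub>1<..<\<tau>\<^sub>2})) \<le> real N\<^sub>0 + (\<tau>\<^sub>2 - \<tau>\<^sub>1) / \<tau>\<^sub>D)}"

definition signals_avg_dwell :: "'g::metric_space set \<Rightarrow> (real \<Rightarrow> 'g) set" where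
  "signals_avg_dwell \<Gamma> = (\<Union>\<tau>\<^sub>D\<in>{0<..}. \<Union>N\<^sub>0. signals_avg_dwell_with \<Gamma> \<tau>\<^sub>D N\<^sub>0)"

subsection \<open>Solutions and trajectories\<close>

text \<open>The sets \<open>\<D>\<close> are the finite families of nonoverlapping compact subintervals of \<open>{a..b}\<close>.\<close>

definition absolutely_cont_on_interval :: "real \<Rightarrow> real \<Rightarrow> (real \<Rightarrow> 'a::euclidean_space) \<Rightarrow> bool" where
  "absolutely_cont_on_interval a b x \<longleftrightarrow>
     (\<forall>\<epsilon>>0. \<exists>\<delta>>0. \<forall>\<D> S. \<D> division_of S \<and> S \<subseteq> {a..b} \<and> (\<Sum>K\<in>\<D>. Sup K - Inf K) < \<delta> \<longrightarrow>
        (\<Sum>K\<in>\<D>. norm (x (Sup K) - x (Inf K))) < \<epsilon>)"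

definition locally_absolutely_cont_on :: "real set \<Rightarrow> (real \<Rightarrow> 'a::euclidean_space) \<Rightarrow> bool" where
  "locally_absolutely_cont_on I x \<longleftrightarrow>
     (\<forall>a b. a \<le> b \<and> {a..b} \<subseteq> I \<longrightarrow> absolutely_cont_on_interval a b x)"

text \<open>
  Caratheodory solutions of \<open>x' = F t x\<close> on the interval \<open>I\<close> under the constraint \<open>x t \<in> X t\<close>;
  used both for the switched equation and for the autonomous equations \<open>x' = g x\<close>.
\<close>

definition solution_on ::
    "real set \<Rightarrow> (real \<Rightarrow> 'a::euclidean_space set) \<Rightarrow> (real \<Rightarrow> 'a \<Rightarrow> 'a) \<Rightarrow> (real \<Rightarrow> 'a) \<Rightarrow> bool" where
  "solution_on I X F x \<longleftrightarrow>
     is_interval I \<and> I \<noteq> {} \<and>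
     locally_absolutely_cont_on I x \<and>
     (\<forall>t\<in>I. x t \<in> X t) \<and>
     (AE t in lebesgue. t \<in> I \<longrightarrow> (x has_vector_derivative F t (x t)) (at t within I))"

definition trajectory ::
    "'g::metric_space set \<Rightarrow> ('a::euclidean_space \<times> 'g) set \<Rightarrow> ('a \<times> 'g \<Rightarrow> 'a) \<Rightarrow>
     real set \<Rightarrow> (real \<Rightarrow> 'a) \<Rightarrow> (real \<Rightarrow> 'g) \<Rightarrow> bool" where
  "trajectory \<Gamma> domf f I x \<sigma> \<longleftrightarrow>
     switching_signal \<Gamma> \<sigma> \<and>
     solution_on I (\<lambda>t. fiber domf (\<sigma> t)) (\<lambda>t \<xi>. f (\<xi>, \<sigma> t)) x"

definition precompact_rel :: "real set \<Rightarrow> (real \<Rightarrow> 'a::euclidean_space) \<Rightarrow> 'a set \<Rightarrow> bool" where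
  "precompact_rel I x S \<longleftrightarrow> (\<exists>B. compact B \<and> B \<subseteq> S \<and> (\<forall>t\<in>I. x t \<in> B))"

text \<open>
  Nonemptiness is required because \<open>infdist \<xi> {} = 0\<close>, whereas the infimum over the empty set
  is \<open>+\<infinity>\<close>.
\<close>

definition tends_to_set :: "(real \<Rightarrow> 'a::euclidean_space) \<Rightarrow> 'a set \<Rightarrow> bool" where
  "tends_to_set x M \<longleftrightarrow> M \<noteq> {} \<and> ((\<lambda>t. infdist (x t) M) \<longlongrightarrow> 0) at_top"

subsection \<open>The class of Lyapunov-like functions\<close>

definition grad :: "('a::euclidean_space \<Rightarrow> real) \<Rightarrow> 'a \<Rightarrow> 'a" where
  "grad F \<xi> = (THE D. GDERIV F \<xi> :> D)"

definition base :: "('a \<times> 'g) set \<Rightarrow> 'a set" where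
  "base domV = fst ` domV"

definition base_at :: "('a \<times> 'g) set \<Rightarrow> ('a \<times> 'g) set \<Rightarrow> 'g \<Rightarrow> 'a set" where
  "base_at domf domV \<gamma> = base domV \<inter> fiber domf \<gamma>"

definition class_V ::
    "'g set \<Rightarrow> ('a::euclidean_space \<times> 'g) set \<Rightarrow> ('a \<times> 'g) set \<Rightarrow> ('a \<times> 'g \<Rightarrow> real) \<Rightarrow> bool" where
  "class_V \<Gamma> domf domV V \<longleftrightarrow>
     domV \<subseteq> UNIV \<times> \<Gamma> \<and>
     (\<forall>\<gamma>\<in>\<Gamma>. open (fiber domV \<gamma>) \<and>
            base_at domf domV \<gamma> \<subseteq> fiber domV \<gamma> \<and>
            (\<forall>\<xi>\<in>base_at domf domV \<gamma>. (\<lambda>\<xi>. V (\<xi>, \<gamma>)) differentiable (at \<xi>)))"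

definition level_set :: "('a \<times> 'g) set \<Rightarrow> ('a \<times> 'g \<Rightarrow> real) \<Rightarrow> 'g \<Rightarrow> real \<Rightarrow> 'a set" where
  "level_set domV V \<gamma> c = {\<xi> \<in> fiber domV \<gamma>. V (\<xi>, \<gamma>) = c}"

definition decrease_condition ::
    "'g set \<Rightarrow> ('a::euclidean_space \<times> 'g) set \<Rightarrow> ('a \<times> 'g \<Rightarrow> 'a) \<Rightarrow>
     ('a \<times> 'g) set \<Rightarrow> ('a \<times> 'g \<Rightarrow> real) \<Rightarrow> ('g \<Rightarrow> 'a \<Rightarrow> real) \<Rightarrow> bool" where
  "decrease_condition \<Gamma> domf f domV V W \<longleftrightarrow>
     (\<forall>\<gamma>\<in>\<Gamma>. \<forall>\<xi>\<in>base_at domf domV \<gamma>.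
        - (grad (\<lambda>\<xi>. V (\<xi>, \<gamma>)) \<xi> \<bullet> f (\<xi>, \<gamma>)) \<ge> W \<gamma> \<xi> \<and> W \<gamma> \<xi> \<ge> 0)"

subsection \<open>Observability-like sets\<close>

text \<open>
  Only finite horizons are needed: the sets for an infinite horizon are contained in those for
  every finite one, so they do not contribute to the unions below.
\<close>

definition obs_fwd_horizon ::
    "'a::euclidean_space set \<Rightarrow> ('a \<Rightarrow> 'a) \<Rightarrow> ('a \<Rightarrow> real) \<Rightarrow> real \<Rightarrow> 'a set" where
  "obs_fwd_horizon X g h \<tau> =
     {\<xi>\<in>X. \<exists>\<phi>. solution_on {0..\<tau>} (\<lambda>_. X) (\<lambda>_. g) \<phi> \<and> \<phi> 0 = \<xi> \<and> (\<forall>t\<in>{0..\<tau>}. h (\<phi> t) = 0)}"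

definition obs_bwd_horizon ::
    "'a::euclidean_space set \<Rightarrow> ('a \<Rightarrow> 'a) \<Rightarrow> ('a \<Rightarrow> real) \<Rightarrow> real \<Rightarrow> 'a set" where
  "obs_bwd_horizon X g h \<tau> =
     {\<xi>\<in>X. \<exists>\<phi>. solution_on {-\<tau>..0} (\<lambda>_. X) (\<lambda>_. g) \<phi> \<and> \<phi> 0 = \<xi> \<and> (\<forall>t\<in>{-\<tau>..0}. h (\<phi> t) = 0)}"

definition obs_fwd :: "'a::euclidean_space set \<Rightarrow> ('a \<Rightarrow> 'a) \<Rightarrow> ('a \<Rightarrow> real) \<Rightarrow> 'a set" where
  "obs_fwd X g h = (\<Union>\<tau>\<in>{0<..}. obs_fwd_horizon X g h \<tau>)"

definition obs_bwd :: "'a::euclidean_space set \<Rightarrow> ('a \<Rightarrow> 'a) \<Rightarrow> ('a \<Rightarrow> real) \<Rightarrow> 'a set" where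
  "obs_bwd X g h = (\<Union>\<tau>\<in>{0<..}. obs_bwd_horizon X g h \<tau>)"

text \<open>The instances with \<open>X = \<O>\<^sub>\<gamma>\<close>, \<open>g = f\<^sub>\<gamma>\<close>, \<open>h = W\<^sub>\<gamma>\<close>.\<close>

definition obs_fwd_at ::
    "('a::euclidean_space \<times> 'g) set \<Rightarrow> ('a \<times> 'g \<Rightarrow> 'a) \<Rightarrow> ('a \<times> 'g) set \<Rightarrow>
     ('g \<Rightarrow> 'a \<Rightarrow> real) \<Rightarrow> 'g \<Rightarrow> 'a set" where
  "obs_fwd_at domf f domV W \<gamma> = obs_fwd (base_at domf domV \<gamma>) (\<lambda>\<xi>. f (\<xi>, \<gamma>)) (W \<gamma>)"

definition obs_bwd_at ::
    "('a::euclidean_space \<times> 'g) set \<Rightarrow> ('a \<times> 'g \<Rightarrow> 'a) \<Rightarrow> ('a \<times> 'g) set \<Rightarrow>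
     ('g \<Rightarrow> 'a \<Rightarrow> real) \<Rightarrow> 'g \<Rightarrow> 'a set" where
  "obs_bwd_at domf f domV W \<gamma> = obs_bwd (base_at domf domV \<gamma>) (\<lambda>\<xi>. f (\<xi>, \<gamma>)) (W \<gamma>)"

end

theory Submission
  imports Defs "HOL-Complex_Analysis.Great_Picard"
begin

text \<open>
  Let \<open>\<xi>\<close> be an \<open>\<omega>\<close>-limit point, \<open>x (T k) \<longlonglongrightarrow> \<xi>\<close>. Average dwell time bounds the number of jumps in
  \<open>{T k<..<T k + 1}\<close>, so along a subsequence all jumps in some \<open>{T k<..<T k + \<delta>}\<close> move into \<open>T k\<close>;
  likewise on the left. By Arzela-Ascoli and compactness of \<open>\<Gamma>\<close> the shifted trajectories then converge
  on \<open>{0..\<delta>}\<close> to a solution \<open>\<phi>\<close> of \<open>x' = f (x, \<gamma>)\<close> starting at \<open>\<xi>\<close>, and on an interval \<open>{-\<delta>'..0}\<close>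
  to a solution for some \<open>\<gamma>'\<close> ending at \<open>\<xi>\<close>. Monotonicity of \<open>v\<close> makes \<open>V\<close> constant along \<open>\<phi>\<close>, and
  \<open>0 = d/dt V (\<phi>, \<gamma>) \<le> - W \<gamma> \<phi> \<le> 0\<close> yields \<open>W \<gamma> \<phi> = 0\<close> without continuity of \<open>W\<close>. If instead
  \<open>V\<close> is merely bounded and \<open>W\<close> is continuous, a positive value of \<open>W \<gamma> \<phi>\<close> would force \<open>v\<close> to drop by a fixed amount near infinitely
  many \<open>T k\<close>, contradicting its convergence.
\<close>

section \<open>Mean value inequality for absolutely continuous functions\<close>

text \<open>Two pieces of a division meet in a convex set with empty interior, which is negligible,
  so the lengths add up to the measure of the union. \<open>T\<close> is later an open cover of the
  exceptional null set.\<close>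

lemma sum_length_division_le_measure:
  fixes \<D> :: "real set set"
  assumes div: "\<D> division_of S" and "S \<subseteq> T" and T: "T \<in> lmeasurable"
  shows "(\<Sum>K\<in>\<D>. Sup K - Inf K) \<le> measure lebesgue T"
proof -
  have K: "K \<noteq> {}" "\<exists>u v. K = cbox u v" if "K \<in> \<D>" for K
    using division_ofD(3,4)[OF div that] by auto
  have "(\<Sum>K\<in>\<D>. Sup K - Inf K) = (\<Sum>K\<in>\<D>. measure lebesgue K)"
  proof (rule sum.cong)
    fix K assume "K \<in> \<D>"
    then obtain u v where uv: "K = {u..v}" "u \<le> v"
      using K[of K] by auto
    then show "Sup K - Inf K = measure lebesgue K"
      by simp
  qed simp
  also have "\<dots> = measure lebesgue (\<Union>\<D>)"
  proof (rule measure_negligible_finite_Union[symmetric])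
    show "finite \<D>" using div by auto
    show "\<And>S. S \<in> \<D> \<Longrightarrow> S \<in> lmeasurable" using K(2) by auto
    show "pairwise (\<lambda>S T. negligible (S \<inter> T)) \<D>"
      unfolding pairwise_def
    proof (intro ballI impI)
      fix K L assume "K \<in> \<D>" "L \<in> \<D>" "K \<noteq> L"
      then have "interior (K \<inter> L) = {}" "convex (K \<inter> L)"
        using div K(2)[of K] K(2)[of L] by (auto intro!: convex_Int)
      then show "negligible (K \<inter> L)"
        using negligible_convex_interior by blast
    qed
  qed
  also have "\<dots> \<le> measure lebesgue T"
  proof (rule measure_mono_fmeasurable)
    show "\<Union>\<D> \<subseteq> T" using div \<open>S \<subseteq> T\<close> by auto
    show "\<Union>\<D> \<in> sets lebesgue"
      using K(2) div by (intro sets.finite_Union) auto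
  qed (rule T)
  finally show ?thesis .
qed

text \<open>The straddle lemma of gauge integration: as \<open>t\<close> lies between
  \<open>u\<close> and \<open>v\<close>, the errors of the two expansions at \<open>t\<close> add up
  to \<epsilon> times \<open>v - u\<close> without loss. Nearness is phrased with balls so that it
  can serve as a gauge.\<close>

lemma has_vector_derivative_straddle:
  fixes x :: "real \<Rightarrow> 'a::real_normed_vector"
  assumes "(x has_vector_derivative D) (at t within S)" "\<epsilon> > 0"
  shows "\<exists>d>0. \<forall>u v. u \<in> S \<and> v \<in> S \<and> u \<le> t \<and> t \<le> v \<and> u \<in> ball t d \<and> v \<in> ball t d
           \<longrightarrow> norm (x v - x u - (v - u) *\<^sub>R D) \<le> \<epsilon> * (v - u)"
proof -
  obtain d where d: "d > 0"
    "\<And>y. y \<in> S \<Longrightarrow> norm (y - t) < d \<Longrightarrow> norm (x y - x t - (y - t) *\<^sub>R D) \<le> \<epsilon> * norm (y - t)"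
    using assms unfolding has_vector_derivative_def has_derivative_within_alt by blast
  show ?thesis
  proof (intro exI[of _ d] conjI allI impI)
    fix u v assume uv: "u \<in> S \<and> v \<in> S \<and> u \<le> t \<and> t \<le> v \<and> u \<in> ball t d \<and> v \<in> ball t d"
    have "x v - x u - (v - u) *\<^sub>R D = (x v - x t - (v - t) *\<^sub>R D) - (x u - x t - (u - t) *\<^sub>R D)"
      by (simp add: algebra_simps)
    also have "norm \<dots> \<le> norm (x v - x t - (v - t) *\<^sub>R D) + norm (x u - x t - (u - t) *\<^sub>R D)"
      by (rule norm_triangle_ineq4)
    also have "\<dots> \<le> \<epsilon> * (v - t) + \<epsilon> * (t - u)"
      using d(2)[of u] d(2)[of v] uv by (intro add_mono) (auto simp: dist_real_def)
    finally show "norm (x v - x u - (v - u) *\<^sub>R D) \<le> \<epsilon> * (v - u)"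
      by (simp add: algebra_simps)
  qed (use d in simp)
qed

text \<open>
  Gauge argument: cover the exceptional set \<open>N\<close> by an open set of small measure. The intervals of a
  fine division tagged in \<open>N\<close> have small total length and are handled by absolute continuity, the
  others by differentiability at the tag.
\<close>

lemma absolutely_cont_mean_value:
  fixes x :: "real \<Rightarrow> 'a::euclidean_space"
  assumes ac: "absolutely_cont_on_interval a b x" and ab: "a \<le> b" and e: "0 \<le> e"
    and N: "negligible N"
    and der: "\<And>t. t \<in> {a..b} - N \<Longrightarrow> (x has_vector_derivative D t) (at t within {a..b})"
    and bd: "\<And>t. t \<in> {a..b} - N \<Longrightarrow> norm (D t - c) \<le> e"
  shows "norm (x b - x a - (b - a) *\<^sub>R c) \<le> e * (b - a)"
proof (rule field_le_epsilon)
  fix \<epsilon>\<^sub>0 :: real assume "\<epsilon>\<^sub>0 > 0"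
  \<comment> \<open>Error budget: \<epsilon> times \<open>b - a\<close> for the intervals tagged
    outside \<open>N\<close>, and twice \<epsilon> for those tagged inside, once for the increments
    of \<open>x\<close> and once for the linear part.\<close>
  define \<epsilon> where "\<epsilon> = \<epsilon>\<^sub>0 / (b - a + 2)"
  have \<epsilon>: "\<epsilon> > 0" "\<epsilon> * (b - a + 2) = \<epsilon>\<^sub>0"
    using \<open>\<epsilon>\<^sub>0 > 0\<close> ab by (auto simp: \<epsilon>_def)
  obtain \<delta> where \<delta>: "\<delta> > 0" "\<And>\<D> S. \<D> division_of S \<Longrightarrow> S \<subseteq> {a..b} \<Longrightarrow>
      (\<Sum>K\<in>\<D>. Sup K - Inf K) < \<delta> \<Longrightarrow> (\<Sum>K\<in>\<D>. norm (x (Sup K) - x (Inf K))) < \<epsilon>"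
    using ac[unfolded absolutely_cont_on_interval_def, rule_format, OF \<epsilon>(1)] by metis
  \<comment> \<open>Total length below \<delta> lets absolute continuity act; the second bound keeps
    the linear part \<open>\<eta> * norm c\<close> below \<epsilon>, with the summand 1 covering c =
    0.\<close>
  define \<eta> where "\<eta> = min \<delta> (\<epsilon> / (norm c + 1))"
  have "\<epsilon> / (norm c + 1) > 0"
    using \<epsilon>(1) by (simp add: add_nonneg_pos)
  then have \<eta>: "\<eta> > 0" "\<eta> \<le> \<delta>" using \<delta>(1) by (auto simp: \<eta>_def)
  have "\<eta> * norm c \<le> \<epsilon> / (norm c + 1) * (norm c + 1)"
    using \<eta>(1) by (intro mult_mono) (auto simp: \<eta>_def)
  then have \<eta>c: "\<eta> * norm c \<le> \<epsilon>"
    by (smt (verit) nonzero_eq_divide_eq norm_ge_zero)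
  have Nnull: "N \<in> null_sets lebesgue" using N negligible_iff_null_sets by blast
  obtain T where T: "open T" "N \<subseteq> T" "T - N \<in> lmeasurable" "emeasure lebesgue (T - N) < ennreal \<eta>"
    using sets_lebesgue_outer_open[of N \<eta>] Nnull \<eta>(1) by blast
  have Tm: "T \<in> lmeasurable"
    using T(2,3) N negligible_imp_measurable by (metis Diff_partition fmeasurable.Un)
  have "measure lebesgue T = measure lebesgue (T - N)"
    using Nnull by (simp add: measure_Diff_null_set fmeasurableD[OF Tm])
  also have "\<dots> < \<eta>"
    using T(3,4) \<eta>(1) by (simp add: emeasure_eq_measure2 ennreal_less_iff)
  finally have mT: "measure lebesgue T < \<eta>" .
  define P where "P t d \<longleftrightarrow> (t \<in> {a..b} - N \<longrightarrow> (\<forall>u v. u \<in> {a..b} \<and> v \<in> {a..b} \<and> u \<le> t \<and> t \<le> v \<and>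
      u \<in> ball t d \<and> v \<in> ball t d \<longrightarrow> norm (x v - x u - (v - u) *\<^sub>R D t) \<le> \<epsilon> * (v - u)))" for t d
  have "\<exists>d>0. P t d" for t
    using has_vector_derivative_straddle[OF der \<epsilon>(1), of t] zero_less_one
    unfolding P_def by (cases "t \<in> {a..b} - N") blast+
  then obtain d where "\<And>t. d t > 0" "\<And>t. P t (d t)"
    by metis
  note d = this[unfolded P_def]
  define g where "g t = (if t \<in> N then T else ball t (d t))" for t
  have "gauge g"
    using T(1,2) d(1) by (auto simp: gauge_def g_def)
  then obtain p where p: "p tagged_division_of {a..b}" "g fine p"
    using fine_division_exists_real by blast
  define q where "q = {(t, K) \<in> p. t \<in> N}"
  define F where "F K = x (Sup K) - x (Inf K) - (Sup K - Inf K) *\<^sub>R c" for K :: "real set"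
  have finp: "finite p" using p(1) by auto
  have pK: "\<exists>u v. K = {u..v} \<and> a \<le> u \<and> u \<le> t \<and> t \<le> v \<and> v \<le> b \<and> Inf K = u \<and> Sup K = v \<and>
      {u..v} \<subseteq> g t"
    if tK: "(t, K) \<in> p" for t K
  proof -
    obtain u v where "K = {u..v}"
      unfolding box_real(2)[symmetric] using tagged_division_ofD(4)[OF p(1) tK] by blast
    moreover have "t \<in> K" "K \<subseteq> {a..b}" "K \<subseteq> g t"
      using tagged_division_ofD(2,3)[OF p(1) tK] p(2) tK by (auto simp: fine_def)
    ultimately show ?thesis by auto
  qed
  have qpart: "q tagged_partial_division_of {a..b}"
    using p(1) unfolding tagged_division_of_def q_def
    by (auto intro: tagged_partial_division_subset[of p])
  have qdiv: "q tagged_division_of (\<Union>(snd ` q))" "(snd ` q) division_of (\<Union>(snd ` q))"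
    by (fact tagged_partial_division_of_Union_self[OF qpart] partial_division_of_tagged_division[OF qpart])+
  \<comment> \<open>Absolute continuity speaks about untagged divisions. An interval can carry two
    tags only if its interior is empty, and such a singleton contributes 0 under
    \<open>G\<close>.\<close>
  have qsum: "(\<Sum>(t, K)\<in>q. G K) = (\<Sum>K\<in>snd ` q. G K)"
    if G: "\<And>u. G {u} = 0" for G :: "real set \<Rightarrow> real"
  proof -
    have *: "(if cbox u v = {} then 0 else G (cbox u v)) = 0" if "box u v = {}" for u v :: real
    proof (cases "u = v")
      case True
      then show ?thesis using G[of v] by simp
    qed (use that in auto)
    have ne: "K \<noteq> {}" if "K \<in> snd ` q" for K
      using division_ofD(3)[OF qdiv(2) that] .
    have "(\<Sum>(t, K)\<in>q. G K) = (\<Sum>(t, K)\<in>q. if K = {} then 0 else G K)"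
      using ne[OF imageI] by (intro sum.cong) (simp_all add: case_prod_unfold)
    also have "\<dots> = (\<Sum>K\<in>snd ` q. if K = {} then 0 else G K)"
      using sum.over_tagged_division_lemma[OF qdiv(1), of "\<lambda>K. if K = {} then 0 else G K"] * by simp
    also have "\<dots> = (\<Sum>K\<in>snd ` q. G K)"
      using ne by (intro sum.cong) simp_all
    finally show ?thesis .
  qed
  have qT: "\<Union>(snd ` q) \<subseteq> T"
    using pK by (fastforce simp: q_def g_def)
  have qlen: "(\<Sum>K\<in>snd ` q. Sup K - Inf K) < \<eta>"
    using sum_length_division_le_measure[OF qdiv(2) qT Tm] mT by simp
  have "(\<Sum>K\<in>snd ` q. norm (x (Sup K) - x (Inf K))) < \<epsilon>"
    using \<delta>(2)[OF qdiv(2)] qlen \<eta>(2) qpart by (fastforce simp: tagged_partial_division_of_def)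
  then have q1: "(\<Sum>(t, K)\<in>q. norm (x (Sup K) - x (Inf K))) < \<epsilon>"
    by (subst qsum) auto
  have q2: "(\<Sum>(t, K)\<in>q. Sup K - Inf K) < \<eta>"
    using qlen by (subst qsum) auto
  have "(\<Sum>(t, K)\<in>q. norm (F K)) \<le>
      (\<Sum>(t, K)\<in>q. norm (x (Sup K) - x (Inf K)) + (Sup K - Inf K) * norm c)"
  proof (rule sum_mono, clarify)
    fix t K assume "(t, K) \<in> q"
    then have "Inf K \<le> Sup K" using pK[of t K] by (auto simp: q_def)
    then show "norm (F K) \<le> norm (x (Sup K) - x (Inf K)) + (Sup K - Inf K) * norm c"
      unfolding F_def by (smt (verit) norm_triangle_ineq4 norm_scaleR)
  qed
  also have "\<dots> = (\<Sum>(t, K)\<in>q. norm (x (Sup K) - x (Inf K))) + (\<Sum>(t, K)\<in>q. Sup K - Inf K) * norm c"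
    by (simp add: sum.distrib sum_distrib_right case_prod_unfold)
  also have "\<dots> \<le> \<epsilon> + \<eta> * norm c"
    using q1 q2 by (intro add_mono mult_right_mono) auto
  finally have Q: "(\<Sum>(t, K)\<in>q. norm (F K)) \<le> \<epsilon> + \<epsilon>" using \<eta>c by simp
  have len: "Sup K - Inf K \<ge> 0" if "(t, K) \<in> p" for t K
    using pK[OF that] by auto
  have "(\<Sum>(t, K)\<in>p - q. norm (F K)) \<le> (\<Sum>(t, K)\<in>p - q. (e + \<epsilon>) * (Sup K - Inf K))"
  proof (rule sum_mono, clarify)
    fix t K assume tK: "(t, K) \<in> p" "(t, K) \<notin> q"
    then have tN: "t \<notin> N" by (auto simp: q_def)
    obtain u v where uv: "K = {u..v}" "a \<le> u" "u \<le> t" "t \<le> v" "v \<le> b" "Inf K = u" "Sup K = v"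
      "{u..v} \<subseteq> ball t (d t)"
      using pK[OF tK(1)] tN by (auto simp: g_def)
    have t: "t \<in> {a..b} - N" using uv tN by auto
    have "u \<in> {u..v}" "v \<in> {u..v}" using uv by auto
    then have "u \<in> ball t (d t)" "v \<in> ball t (d t)" using uv(8) by blast+
    then have 1: "norm (x v - x u - (v - u) *\<^sub>R D t) \<le> \<epsilon> * (v - u)"
      using d(2)[rule_format, OF t, of u v] uv by auto
    have 2: "norm ((v - u) *\<^sub>R (D t - c)) \<le> (v - u) * e"
      using bd[OF t] uv by (auto intro: mult_left_mono)
    have "F K = (x v - x u - (v - u) *\<^sub>R D t) + (v - u) *\<^sub>R (D t - c)"
      by (simp add: F_def uv(6,7) algebra_simps)
    then have "norm (F K) \<le> \<epsilon> * (v - u) + (v - u) * e"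
      using 1 2 norm_triangle_mono by metis
    then show "norm (F K) \<le> (e + \<epsilon>) * (Sup K - Inf K)"
      by (simp only: uv(6,7)) (simp add: algebra_simps)
  qed
  also have "\<dots> \<le> (\<Sum>(t, K)\<in>p. (e + \<epsilon>) * (Sup K - Inf K))"
    using finp len e \<epsilon>(1) by (intro sum_mono2) auto
  also have "\<dots> = (e + \<epsilon>) * (b - a)"
    using additive_tagged_division_1[OF ab p(1), of "\<lambda>t. t"]
    by (simp add: sum_distrib_left[symmetric] case_prod_unfold)
  finally have P: "(\<Sum>(t, K)\<in>p - q. norm (F K)) \<le> (e + \<epsilon>) * (b - a)" .
  \<comment> \<open>The increments of \<open>x t - t *\<^sub>R c\<close> telescope over the
    division.\<close>
  have "x b - x a - (b - a) *\<^sub>R c = (\<Sum>(t, K)\<in>p. F K)"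
    using additive_tagged_division_1[OF ab p(1), of "\<lambda>t. x t - t *\<^sub>R c"]
    by (simp add: F_def algebra_simps)
  also have "norm \<dots> \<le> (\<Sum>(t, K)\<in>p. norm (F K))"
    by (rule order_trans[OF norm_sum]) (simp add: case_prod_unfold)
  also have "\<dots> = (\<Sum>(t, K)\<in>p - q. norm (F K)) + (\<Sum>(t, K)\<in>q. norm (F K))"
    using finp by (intro sum.subset_diff) (auto simp: q_def)
  also have "\<dots> \<le> (e + \<epsilon>) * (b - a) + (\<epsilon> + \<epsilon>)"
    using P Q by (rule add_mono)
  also have "\<dots> = e * (b - a) + \<epsilon>\<^sub>0"
    using \<epsilon>(2) by (simp add: algebra_simps)
  finally show "norm (x b - x a - (b - a) *\<^sub>R c) \<le> e * (b - a) + \<epsilon>\<^sub>0" .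
qed

lemma lipschitz_on_imp_locally_absolutely_cont_on:
  fixes x :: "real \<Rightarrow> 'a::euclidean_space"
  assumes lip: "M-lipschitz_on I x"
  shows "locally_absolutely_cont_on I x"
  unfolding locally_absolutely_cont_on_def absolutely_cont_on_interval_def
proof (intro allI impI)
  fix a b \<epsilon> :: real assume ab: "a \<le> b \<and> {a..b} \<subseteq> I" and \<epsilon>: "\<epsilon> > 0"
  have M: "M \<ge> 0" using lip by (rule lipschitz_on_nonneg)
  show "\<exists>\<delta>>0. \<forall>\<D> S. \<D> division_of S \<and> S \<subseteq> {a..b} \<and> (\<Sum>K\<in>\<D>. Sup K - Inf K) < \<delta> \<longrightarrow>
        (\<Sum>K\<in>\<D>. norm (x (Sup K) - x (Inf K))) < \<epsilon>"
  \<comment> \<open>The summand 1 avoids division by 0 when M = 0 and makes the final estimate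
    strict.\<close>
  proof (intro exI[of _ "\<epsilon> / (M + 1)"] conjI allI impI)
    show "\<epsilon> / (M + 1) > 0" using M \<epsilon> by simp
    fix \<D> S assume *: "\<D> division_of S \<and> S \<subseteq> {a..b} \<and> (\<Sum>K\<in>\<D>. Sup K - Inf K) < \<epsilon> / (M + 1)"
    have K: "\<exists>u v. K = {u..v} \<and> a \<le> u \<and> u \<le> v \<and> v \<le> b" if "K \<in> \<D>" for K
    proof -
      have "K \<noteq> {}" "K \<subseteq> {a..b}" "\<exists>u v. K = {u..v}"
        using division_ofD(2-4)[OF conjunct1[OF *] that] * by auto
      then show ?thesis by fastforce
    qed
    have "(\<Sum>K\<in>\<D>. norm (x (Sup K) - x (Inf K))) \<le> (\<Sum>K\<in>\<D>. M * (Sup K - Inf K))"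
    proof (rule sum_mono)
      fix K assume "K \<in> \<D>"
      then obtain u v where "K = {u..v}" "a \<le> u" "u \<le> v" "v \<le> b" using K by blast
      then show "norm (x (Sup K) - x (Inf K)) \<le> M * (Sup K - Inf K)"
        using lipschitz_onD[OF lip, of v u] ab by (auto simp: dist_norm subset_iff)
    qed
    also have "\<dots> = M * (\<Sum>K\<in>\<D>. Sup K - Inf K)" by (simp add: sum_distrib_left)
    also have "\<dots> \<le> M * (\<epsilon> / (M + 1))" using * M by (intro mult_left_mono) auto
    also have "\<dots> < \<epsilon>" using M \<epsilon> by (simp add: field_simps)
    finally show "(\<Sum>K\<in>\<D>. norm (x (Sup K) - x (Inf K))) < \<epsilon>" .
  qed
qed

section \<open>Limits of solutions\<close>

text \<open>
  A substitute for \<open>x \<beta> - x \<alpha> = \<integral>g\<close> that avoids integrals and passes to pointwise limits.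
\<close>

definition increments_controlled ::
    "real set \<Rightarrow> (real \<Rightarrow> 'a::real_normed_vector) \<Rightarrow> (real \<Rightarrow> 'a) \<Rightarrow> bool" where
  "increments_controlled I x g \<longleftrightarrow>
     (\<forall>\<alpha> \<beta> c e. \<alpha> \<le> \<beta> \<and> {\<alpha>..\<beta>} \<subseteq> I \<and> (\<forall>t\<in>{\<alpha>..\<beta>}. norm (g t - c) \<le> e) \<longrightarrow>
        norm (x \<beta> - x \<alpha> - (\<beta> - \<alpha>) *\<^sub>R c) \<le> e * (\<beta> - \<alpha>))"

lemma increments_controlledD:
  assumes "increments_controlled I x g" "\<alpha> \<le> \<beta>" "{\<alpha>..\<beta>} \<subseteq> I"
    "\<And>t. t \<in> {\<alpha>..\<beta>} \<Longrightarrow> norm (g t - c) \<le> e"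
  shows "norm (x \<beta> - x \<alpha> - (\<beta> - \<alpha>) *\<^sub>R c) \<le> e * (\<beta> - \<alpha>)"
  using assms unfolding increments_controlled_def by blast

lemma increments_controlled_subset:
  "increments_controlled I x g \<Longrightarrow> J \<subseteq> I \<Longrightarrow> increments_controlled J x g"
  unfolding increments_controlled_def by (meson subset_trans)

lemma increments_controlled_shift:
  assumes "increments_controlled I x g" "\<And>t. t \<in> J \<Longrightarrow> s + t \<in> I"
  shows "increments_controlled J (\<lambda>t. x (s + t)) (\<lambda>t. g (s + t))"
  unfolding increments_controlled_def
proof (intro allI impI, elim conjE)
  fix \<alpha> \<beta> c e
  assume *: "\<alpha> \<le> \<beta>" "{\<alpha>..\<beta>} \<subseteq> J" "\<forall>t\<in>{\<alpha>..\<beta>}. norm (g (s + t) - c) \<le> e"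
  have "norm (x (s + \<beta>) - x (s + \<alpha>) - ((s + \<beta>) - (s + \<alpha>)) *\<^sub>R c) \<le> e * ((s + \<beta>) - (s + \<alpha>))"
  proof (rule increments_controlledD[OF assms(1)])
    have mem: "t - s \<in> {\<alpha>..\<beta>}" if "t \<in> {s + \<alpha>..s + \<beta>}" for t using that by auto
    then show "{s + \<alpha>..s + \<beta>} \<subseteq> I"
      using assms(2)[of "t - s" for t] *(2) by (metis add.commute diff_add_cancel subset_iff)
    show "norm (g t - c) \<le> e" if "t \<in> {s + \<alpha>..s + \<beta>}" for t
      using *(3)[rule_format, OF mem[OF that]] by simp
  qed (use *(1) in simp)
  then show "norm (x (s + \<beta>) - x (s + \<alpha>) - (\<beta> - \<alpha>) *\<^sub>R c) \<le> e * (\<beta> - \<alpha>)" by simp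
qed

text \<open>The mean value inequality absorbs the null set of exceptional times. From here on the
  differential equation of the trajectory enters only through increments, which survive limits while
  derivatives need not.\<close>

lemma solution_on_increments_controlled:
  assumes "solution_on I X F x"
  shows "increments_controlled I x (\<lambda>t. F t (x t))"
  unfolding increments_controlled_def
proof (intro allI impI, elim conjE)
  fix \<alpha> \<beta> c e
  assume *: "\<alpha> \<le> \<beta>" "{\<alpha>..\<beta>} \<subseteq> I" "\<forall>t\<in>{\<alpha>..\<beta>}. norm (F t (x t) - c) \<le> e"
  have "AE t in lebesgue. t \<in> I \<longrightarrow> (x has_vector_derivative F t (x t)) (at t within I)"
    using assms by (simp add: solution_on_def)
  then obtain N where N: "N \<in> null_sets lebesgue"
    "\<And>t. t \<notin> N \<Longrightarrow> t \<in> I \<Longrightarrow> (x has_vector_derivative F t (x t)) (at t within I)"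
    unfolding eventually_ae_filter by auto
  show "norm (x \<beta> - x \<alpha> - (\<beta> - \<alpha>) *\<^sub>R c) \<le> e * (\<beta> - \<alpha>)"
  proof (rule absolutely_cont_mean_value)
    show "absolutely_cont_on_interval \<alpha> \<beta> x"
      using assms *(1,2) by (auto simp: solution_on_def locally_absolutely_cont_on_def)
    show "0 \<le> e"
      using *(1,3) norm_ge_zero order_trans by (metis atLeastAtMost_iff order_refl)
    show "negligible N" using N(1) by (simp add: negligible_iff_null_sets)
    show "(x has_vector_derivative F t (x t)) (at t within {\<alpha>..\<beta>})" if "t \<in> {\<alpha>..\<beta>} - N" for t
      using has_vector_derivative_within_subset[OF N(2) *(2)] that *(2) by blast
  qed (use * in auto)
qed

text \<open>The choice c = 0 turns the increment estimate into a speed bound.\<close>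

lemma increments_controlled_lipschitz:
  assumes "increments_controlled I x g" "is_interval I" "\<And>t. t \<in> I \<Longrightarrow> norm (g t) \<le> M" "0 \<le> M"
  shows "M-lipschitz_on I x"
proof (rule lipschitz_onI)
  have *: "dist (x s) (x t) \<le> M * dist s t" if "s \<in> I" "t \<in> I" "s \<le> t" for s t
  proof -
    have sub: "{s..t} \<subseteq> I"
      using that assms(2) by (meson atLeastAtMost_iff is_interval_1 subsetI)
    have "norm (x t - x s - (t - s) *\<^sub>R 0) \<le> M * (t - s)"
      by (rule increments_controlledD[OF assms(1) that(3) sub]) (use assms(3) sub in auto)
    then show ?thesis using that(3) by (simp add: dist_norm norm_minus_commute)
  qed
  fix s t assume "s \<in> I" "t \<in> I"
  then show "dist (x s) (x t) \<le> M * dist s t"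
    using *[of s t] *[of t s] by (cases "s \<le> t") (auto simp: dist_commute)
qed (rule assms(4))

lemma dist_Pair_less:
  assumes "dist x y < e / 2" "dist u v < e / 2"
  shows "dist (x, u) (y, v) < e"
proof -
  have "dist (x, u) (y, v) \<le> dist x y + dist u v"
    unfolding dist_Pair_Pair by (intro sqrt_sum_squares_le_sum) auto
  then show ?thesis using assms by simp
qed

lemma lipschitz_on_limit_seq:
  assumes lip: "\<forall>\<^sub>F k in sequentially. M-lipschitz_on S (u k)"
    and lim: "\<And>t. t \<in> S \<Longrightarrow> (\<lambda>k. u k t) \<longlonglongrightarrow> \<phi> t"
  shows "M-lipschitz_on S \<phi>"
proof (rule lipschitz_onI)
  show "0 \<le> M"
    using eventually_happens[OF lip] lipschitz_on_nonneg by auto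
  fix s t assume "s \<in> S" "t \<in> S"
  then have "(\<lambda>k. dist (u k s) (u k t)) \<longlonglongrightarrow> dist (\<phi> s) (\<phi> t)"
    by (intro tendsto_dist lim)
  then show "dist (\<phi> s) (\<phi> t) \<le> M * dist s t"
    using lip \<open>s \<in> S\<close> \<open>t \<in> S\<close>
    by (elim tendsto_upperbound) (auto elim!: eventually_mono dest: lipschitz_onD)
qed

text \<open>Continuity of \<open>f\<close> at \<open>(\<phi> t, \<gamma>)\<close> makes all
  velocities near \<open>t\<close> almost equal for large \<open>k\<close>; the increment estimate
  with this common velocity passes to the limit and is a derivative at every time. Jumps may persist
  at the endpoints, so \<open>s\<close> is required to converge only inside.\<close>

lemma limit_solution:
  fixes u :: "nat \<Rightarrow> real \<Rightarrow> 'a::euclidean_space" and s :: "nat \<Rightarrow> real \<Rightarrow> 'g::metric_space"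
  assumes ab: "a < b" and clD: "closed D" and contf: "continuous_on D f"
    and lip: "\<forall>\<^sub>F k in sequentially. M-lipschitz_on {a..b} (u k)"
    and incr: "\<forall>\<^sub>F k in sequentially. increments_controlled {a..b} (u k) (\<lambda>t. f (u k t, s k t))"
    and mem: "\<forall>\<^sub>F k in sequentially. \<forall>t\<in>{a..b}. (u k t, s k t) \<in> D"
    and lim: "\<And>t. t \<in> {a..b} \<Longrightarrow> (\<lambda>k. u k t) \<longlonglongrightarrow> \<phi> t"
    and unif: "\<And>\<alpha> \<beta>. a < \<alpha> \<Longrightarrow> \<alpha> < \<beta> \<Longrightarrow> \<beta> < b \<Longrightarrow> uniform_limit {\<alpha>..\<beta>} s (\<lambda>_. \<gamma>) sequentially"
    and t: "t \<in> {a..b}"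
  shows "(\<phi> t, \<gamma>) \<in> D" and "(\<phi> has_vector_derivative f (\<phi> t, \<gamma>)) (at t within {a..b})"
proof -
  have lip\<phi>: "M-lipschitz_on {a..b} \<phi>"
    using lip lim by (rule lipschitz_on_limit_seq)
  then have cont: "continuous_on {a..b} \<phi>" by (rule lipschitz_on_continuous_on)
  have M: "M \<ge> 0" using lip\<phi> by (rule lipschitz_on_nonneg)
  \<comment> \<open>At interior times both components converge and \<open>D\<close> is closed. The
    endpoints follow by density and continuity of \<phi>, since \<open>s\<close> need not converge
    there.\<close>
  have inner: "(\<phi> r, \<gamma>) \<in> D" if r: "r \<in> {a<..<b}" for r
  proof -
    obtain \<alpha> \<beta> where \<alpha>\<beta>: "a < \<alpha>" "\<alpha> < r" "r < \<beta>" "\<beta> < b"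
      using r dense by (metis greaterThanLessThan_iff)
    have "(\<lambda>k. s k r) \<longlonglongrightarrow> \<gamma>"
      using tendsto_uniform_limitI[OF unif[of \<alpha> \<beta>], of r] \<alpha>\<beta> by auto
    then have "(\<lambda>k. (u k r, s k r)) \<longlonglongrightarrow> (\<phi> r, \<gamma>)"
      using lim[of r] r by (intro tendsto_Pair) auto
    moreover have "\<forall>\<^sub>F k in sequentially. (u k r, s k r) \<in> D"
      using mem r by (auto elim!: eventually_mono)
    ultimately show ?thesis
      using clD by (intro Lim_in_closed_set[of D]) auto
  qed
  have all: "(\<phi> r, \<gamma>) \<in> D" if r: "r \<in> {a..b}" for r
  proof -
    have "continuous_on {a..b} (\<lambda>t. (\<phi> t, \<gamma>))"
      using cont by (intro continuous_intros)
    then have "(\<lambda>t. (\<phi> t, \<gamma>)) ` closure {a<..<b} \<subseteq> D"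
      using ab clD inner by (intro image_closure_subset) auto
    then show ?thesis using r ab by auto
  qed
  then show tD: "(\<phi> t, \<gamma>) \<in> D" using t by blast
  have key: "\<exists>\<rho>>0. \<forall>\<alpha> \<beta>. a < \<alpha> \<and> \<alpha> < \<beta> \<and> \<beta> < b \<and> \<bar>\<alpha> - t\<bar> < \<rho> \<and> \<bar>\<beta> - t\<bar> < \<rho> \<longrightarrow>
       norm (\<phi> \<beta> - \<phi> \<alpha> - (\<beta> - \<alpha>) *\<^sub>R f (\<phi> t, \<gamma>)) \<le> \<epsilon> * (\<beta> - \<alpha>)" if \<epsilon>: "\<epsilon> > 0" for \<epsilon>
  proof -
    obtain \<eta> where \<eta>: "\<eta> > 0" "\<And>p. p \<in> D \<Longrightarrow> dist p (\<phi> t, \<gamma>) < \<eta> \<Longrightarrow> dist (f p) (f (\<phi> t, \<gamma>)) < \<epsilon>"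
      using contf tD \<epsilon> unfolding continuous_on_iff by metis
    \<comment> \<open>The way from \<open>u k r\<close> to \<open>\<phi> t\<close> leads through
      \<open>u k \<alpha>\<close> and \<open>\<phi> \<alpha>\<close>. Its three legs cost at most
      \<open>2 * M * \<rho>\<close>, \<eta> / 12 and \<open>M * \<rho>\<close>, in total less than
      \<eta> / 2.\<close>
    define \<rho> where "\<rho> = \<eta> / (12 * (M + 1))"
    have \<rho>: "\<rho> > 0" "M * \<rho> < \<eta> / 12"
      using M \<eta>(1) by (auto simp: \<rho>_def field_simps)
    show ?thesis
    proof (intro exI[of _ \<rho>] conjI allI impI)
      fix \<alpha> \<beta> assume "a < \<alpha> \<and> \<alpha> < \<beta> \<and> \<beta> < b \<and> \<bar>\<alpha> - t\<bar> < \<rho> \<and> \<bar>\<beta> - t\<bar> < \<rho>"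
      then have \<alpha>\<beta>: "a < \<alpha>" "\<alpha> < \<beta>" "\<beta> < b" "\<bar>\<alpha> - t\<bar> < \<rho>" "\<bar>\<beta> - t\<bar> < \<rho>" by auto
      have "\<forall>\<^sub>F k in sequentially. dist (u k \<alpha>) (\<phi> \<alpha>) < \<eta> / 12"
        by (intro tendstoD[OF lim]) (use \<alpha>\<beta> \<eta>(1) in auto)
      moreover have "\<forall>\<^sub>F k in sequentially. \<forall>r\<in>{\<alpha>..\<beta>}. dist (s k r) \<gamma> < \<eta> / 2"
        by (rule uniform_limitD[OF unif[OF \<alpha>\<beta>(1-3)]]) (use \<eta>(1) in simp)
      ultimately have "\<forall>\<^sub>F k in sequentially.
          norm (u k \<beta> - u k \<alpha> - (\<beta> - \<alpha>) *\<^sub>R f (\<phi> t, \<gamma>)) \<le> \<epsilon> * (\<beta> - \<alpha>)"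
        using lip incr mem
      proof eventually_elim
        case (elim k)
        show ?case
        proof (rule increments_controlledD[OF elim(4)])
          show "{\<alpha>..\<beta>} \<subseteq> {a..b}" using \<alpha>\<beta> by auto
          fix r assume r: "r \<in> {\<alpha>..\<beta>}"
          have "dist (u k r) (u k \<alpha>) \<le> M * dist r \<alpha>" "dist (\<phi> \<alpha>) (\<phi> t) \<le> M * dist \<alpha> t"
            using lipschitz_onD[OF elim(3), of r \<alpha>] lipschitz_onD[OF lip\<phi>, of \<alpha> t] r \<alpha>\<beta> t by auto
          moreover have "M * dist r \<alpha> \<le> M * (2 * \<rho>)" "M * dist \<alpha> t \<le> M * \<rho>"
            using r \<alpha>\<beta> M by (auto intro!: mult_left_mono simp: dist_real_def)
          moreover have "dist (u k r) (\<phi> t) \<le> dist (u k r) (u k \<alpha>) + dist (u k \<alpha>) (\<phi> \<alpha>) + dist (\<phi> \<alpha>) (\<phi> t)"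
            by metric
          ultimately have "dist (u k r) (\<phi> t) < \<eta> / 2"
            using elim(1) \<rho>(2) \<eta>(1) by linarith
          then have "dist (u k r, s k r) (\<phi> t, \<gamma>) < \<eta>"
            using elim(2) r by (intro dist_Pair_less) auto
          moreover have "(u k r, s k r) \<in> D" using elim(5) r \<alpha>\<beta> by auto
          ultimately have "dist (f (u k r, s k r)) (f (\<phi> t, \<gamma>)) < \<epsilon>" by (intro \<eta>(2))
          then show "norm (f (u k r, s k r) - f (\<phi> t, \<gamma>)) \<le> \<epsilon>" by (simp add: dist_norm)
        qed (use \<alpha>\<beta> in simp)
      qed
      moreover have "(\<lambda>k. norm (u k \<beta> - u k \<alpha> - (\<beta> - \<alpha>) *\<^sub>R f (\<phi> t, \<gamma>))) \<longlonglongrightarrow>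
          norm (\<phi> \<beta> - \<phi> \<alpha> - (\<beta> - \<alpha>) *\<^sub>R f (\<phi> t, \<gamma>))"
        using \<alpha>\<beta> by (intro tendsto_norm tendsto_diff lim tendsto_const) auto
      ultimately show "norm (\<phi> \<beta> - \<phi> \<alpha> - (\<beta> - \<alpha>) *\<^sub>R f (\<phi> t, \<gamma>)) \<le> \<epsilon> * (\<beta> - \<alpha>)"
        by (intro tendsto_upperbound) auto
    qed (rule \<rho>(1))
  qed
  \<comment> \<open>Continuity of \<phi> extends the estimate to intervals touching \<open>a\<close>
    or \<open>b\<close>, which are approximated from within. Taking \<open>t\<close> itself as one
    end then gives the derivative, also at the endpoints.\<close>
  have key': "\<exists>\<rho>>0. \<forall>\<alpha> \<beta>. a \<le> \<alpha> \<and> \<alpha> < \<beta> \<and> \<beta> \<le> b \<and> \<bar>\<alpha> - t\<bar> < \<rho> \<and> \<bar>\<beta> - t\<bar> < \<rho> \<longrightarrow>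
       norm (\<phi> \<beta> - \<phi> \<alpha> - (\<beta> - \<alpha>) *\<^sub>R f (\<phi> t, \<gamma>)) \<le> \<epsilon> * (\<beta> - \<alpha>)" if \<epsilon>: "\<epsilon> > 0" for \<epsilon>
  proof -
    obtain \<rho> where \<rho>: "\<rho> > 0" "\<And>\<alpha> \<beta>. a < \<alpha> \<Longrightarrow> \<alpha> < \<beta> \<Longrightarrow> \<beta> < b \<Longrightarrow> \<bar>\<alpha> - t\<bar> < \<rho> \<Longrightarrow> \<bar>\<beta> - t\<bar> < \<rho> \<Longrightarrow>
       norm (\<phi> \<beta> - \<phi> \<alpha> - (\<beta> - \<alpha>) *\<^sub>R f (\<phi> t, \<gamma>)) \<le> \<epsilon> * (\<beta> - \<alpha>)"
      using key[OF \<epsilon>] by metis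
    show ?thesis
    proof (intro exI[of _ \<rho>] conjI allI impI)
      fix \<alpha> \<beta> assume "a \<le> \<alpha> \<and> \<alpha> < \<beta> \<and> \<beta> \<le> b \<and> \<bar>\<alpha> - t\<bar> < \<rho> \<and> \<bar>\<beta> - t\<bar> < \<rho>"
      then have \<alpha>\<beta>: "a \<le> \<alpha>" "\<alpha> < \<beta>" "\<beta> \<le> b" "\<bar>\<alpha> - t\<bar> < \<rho>" "\<bar>\<beta> - t\<bar> < \<rho>" by auto
      \<comment> \<open>The denominators start at 3: two margins of at most a third of the length
        each leave \<open>p n < q n\<close>.\<close>
      define h where "h n = (\<beta> - \<alpha>) * inverse (real (Suc (Suc (Suc n))))" for n
      define p where "p n = \<alpha> + h n" for n
      define q where "q n = \<beta> - h n" for n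
      have pq: "\<alpha> < p n \<and> p n < q n \<and> q n < \<beta>" for n
      proof -
        have "h n \<le> (\<beta> - \<alpha>) * inverse 3"
          using \<alpha>\<beta>(2) unfolding h_def by (intro mult_left_mono le_imp_inverse_le) auto
        moreover have "0 < h n"
          using \<alpha>\<beta>(2) by (simp add: h_def)
        ultimately show ?thesis using \<alpha>\<beta>(2) by (simp add: p_def q_def field_simps)
      qed
      have pq_in: "a \<le> p n" "p n \<le> b" "a \<le> q n" "q n \<le> b" for n
        using pq[of n] \<alpha>\<beta> by auto
      have "(\<lambda>n. inverse (real (Suc (n + 2)))) \<longlonglongrightarrow> 0"
        using LIMSEQ_inverse_real_of_nat LIMSEQ_ignore_initial_segment by blast
      then have lim0: "(\<lambda>n. inverse (real (Suc (Suc (Suc n))))) \<longlonglongrightarrow> 0" by simp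
      have "p \<longlonglongrightarrow> \<alpha> + (\<beta> - \<alpha>) * 0" "q \<longlonglongrightarrow> \<beta> - (\<beta> - \<alpha>) * 0"
        unfolding p_def q_def h_def by (intro tendsto_intros lim0)+
      then have plim: "p \<longlonglongrightarrow> \<alpha>" and qlim: "q \<longlonglongrightarrow> \<beta>" by auto
      have "(\<lambda>n. \<phi> (p n)) \<longlonglongrightarrow> \<phi> \<alpha>" "(\<lambda>n. \<phi> (q n)) \<longlonglongrightarrow> \<phi> \<beta>"
        using pq_in \<alpha>\<beta> by (auto intro!: continuous_on_tendsto_compose[OF cont] plim qlim)
      then have "(\<lambda>n. norm (\<phi> (q n) - \<phi> (p n) - (q n - p n) *\<^sub>R f (\<phi> t, \<gamma>))) \<longlonglongrightarrow>
          norm (\<phi> \<beta> - \<phi> \<alpha> - (\<beta> - \<alpha>) *\<^sub>R f (\<phi> t, \<gamma>))"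
        by (intro tendsto_intros plim qlim)
      moreover have "(\<lambda>n. \<epsilon> * (q n - p n)) \<longlonglongrightarrow> \<epsilon> * (\<beta> - \<alpha>)"
        by (intro tendsto_intros plim qlim)
      moreover have "norm (\<phi> (q n) - \<phi> (p n) - (q n - p n) *\<^sub>R f (\<phi> t, \<gamma>)) \<le> \<epsilon> * (q n - p n)" for n
        using pq[of n] \<alpha>\<beta> by (intro \<rho>(2)) auto
      ultimately show "norm (\<phi> \<beta> - \<phi> \<alpha> - (\<beta> - \<alpha>) *\<^sub>R f (\<phi> t, \<gamma>)) \<le> \<epsilon> * (\<beta> - \<alpha>)"
        by (intro LIMSEQ_le) auto
    qed (rule \<rho>(1))
  qed
  show "(\<phi> has_vector_derivative f (\<phi> t, \<gamma>)) (at t within {a..b})"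
    unfolding has_vector_derivative_def has_derivative_within_alt
  proof (intro conjI allI impI)
    show "bounded_linear (\<lambda>h. h *\<^sub>R f (\<phi> t, \<gamma>))" by (rule bounded_linear_scaleR_left)
    fix \<epsilon> :: real assume "\<epsilon> > 0"
    then obtain \<rho> where \<rho>: "\<rho> > 0" "\<And>\<alpha> \<beta>. a \<le> \<alpha> \<Longrightarrow> \<alpha> < \<beta> \<Longrightarrow> \<beta> \<le> b \<Longrightarrow> \<bar>\<alpha> - t\<bar> < \<rho> \<Longrightarrow> \<bar>\<beta> - t\<bar> < \<rho> \<Longrightarrow>
       norm (\<phi> \<beta> - \<phi> \<alpha> - (\<beta> - \<alpha>) *\<^sub>R f (\<phi> t, \<gamma>)) \<le> \<epsilon> * (\<beta> - \<alpha>)"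
      using key' by metis
    show "\<exists>d>0. \<forall>y\<in>{a..b}. norm (y - t) < d \<longrightarrow>
        norm (\<phi> y - \<phi> t - (y - t) *\<^sub>R f (\<phi> t, \<gamma>)) \<le> \<epsilon> * norm (y - t)"
    proof (intro exI[of _ \<rho>] conjI ballI impI)
      fix y assume y: "y \<in> {a..b}" "norm (y - t) < \<rho>"
      consider "y = t" | "y < t" | "t < y" by linarith
      then show "norm (\<phi> y - \<phi> t - (y - t) *\<^sub>R f (\<phi> t, \<gamma>)) \<le> \<epsilon> * norm (y - t)"
      proof cases
        case 2
        have "\<phi> y - \<phi> t - (y - t) *\<^sub>R f (\<phi> t, \<gamma>) = - (\<phi> t - \<phi> y - (t - y) *\<^sub>R f (\<phi> t, \<gamma>))"
          by (simp add: algebra_simps)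
        then have "norm (\<phi> y - \<phi> t - (y - t) *\<^sub>R f (\<phi> t, \<gamma>)) = norm (\<phi> t - \<phi> y - (t - y) *\<^sub>R f (\<phi> t, \<gamma>))"
          by (metis norm_minus_cancel)
        then show ?thesis using \<rho>(1) \<rho>(2)[of y t] y t 2 by auto
      next
        case 3
        then show ?thesis using \<rho>(1) \<rho>(2)[of t y] y t by auto
      qed simp
    qed (rule \<rho>(1))
  qed
qed

text \<open>
  Either infinitely many of the sets have fewer points in some smaller interval, or all their
  points in \<open>{0<..<\<delta>\<^sub>0}\<close> accumulate at 0.
\<close>

lemma jump_free_subsequence:
  fixes J :: "nat \<Rightarrow> real set"
  assumes "0 < \<delta>\<^sub>0" "\<And>k. finite (J k \<inter> {0<..<\<delta>\<^sub>0})" "\<And>k. card (J k \<inter> {0<..<\<delta>\<^sub>0}) \<le> n"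
  shows "\<exists>\<delta> r. 0 < \<delta> \<and> \<delta> \<le> \<delta>\<^sub>0 \<and> strict_mono (r :: nat \<Rightarrow> nat) \<and>
     (\<forall>\<alpha>>0. \<forall>\<^sub>F k in sequentially. J (r k) \<inter> {\<alpha><..<\<delta>} = {})"
  using assms
proof (induction n arbitrary: J \<delta>\<^sub>0)
  case 0
  then have "J k \<inter> {0<..<\<delta>\<^sub>0} = {}" for k by simp
  then have "J k \<inter> {\<alpha><..<\<delta>\<^sub>0} = {}" if "\<alpha> > 0" for k \<alpha>
    using that by fastforce
  then show ?case
    using 0(1) by (intro exI[of _ \<delta>\<^sub>0] exI[of _ id]) (auto simp: strict_mono_def)
next
  case (Suc n)
  show ?case
  proof (cases "\<exists>\<delta>. 0 < \<delta> \<and> \<delta> \<le> \<delta>\<^sub>0 \<and> infinite {k. card (J k \<inter> {0<..<\<delta>}) \<le> n}")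
    case True
    then obtain \<delta> where \<delta>: "0 < \<delta>" "\<delta> \<le> \<delta>\<^sub>0" "infinite {k. card (J k \<inter> {0<..<\<delta>}) \<le> n}" by blast
    obtain r :: "nat \<Rightarrow> nat" where r: "strict_mono r" "\<And>k. card (J (r k) \<inter> {0<..<\<delta>}) \<le> n"
      using infinite_enumerate[OF \<delta>(3)] by blast
    have "finite (J (r k) \<inter> {0<..<\<delta>})" for k
      by (rule finite_subset[OF _ Suc.prems(2)[of "r k"]]) (use \<delta>(2) in auto)
    then obtain \<delta>' r' where "0 < \<delta>'" "\<delta>' \<le> \<delta>" "strict_mono (r' :: nat \<Rightarrow> nat)"
      "\<forall>\<alpha>>0. \<forall>\<^sub>F k in sequentially. J (r (r' k)) \<inter> {\<alpha><..<\<delta>'} = {}"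
      using Suc.IH[OF \<delta>(1), of "\<lambda>k. J (r k)"] r(2) by blast
    then show ?thesis
      using \<delta>(2) r(1) by (intro exI[of _ \<delta>'] exI[of _ "\<lambda>k. r (r' k)"]) (auto simp: strict_mono_def)
  next
    case False
    \<comment> \<open>For \<alpha> below \<open>\<delta>\<^sub>0\<close>, all but finitely many
      \<open>k\<close> have more than \<open>n\<close> points below \<alpha>. At most
      \<open>Suc n\<close> exist below \<open>\<delta>\<^sub>0\<close>, so none is left above
      \<alpha>, and the full sequence serves.\<close>
    have "\<forall>\<^sub>F k in sequentially. J k \<inter> {\<alpha><..<\<delta>\<^sub>0} = {}" if \<alpha>: "\<alpha> > 0" for \<alpha>
    proof (cases "\<alpha> < \<delta>\<^sub>0")
      case True
      then have "finite {k. card (J k \<inter> {0<..<\<alpha>}) \<le> n}" using False \<alpha> by force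
      then have "\<forall>\<^sub>F k in sequentially. \<not> card (J k \<inter> {0<..<\<alpha>}) \<le> n"
        by (simp add: cofinite_eq_sequentially[symmetric] eventually_cofinite)
      then show ?thesis
      proof eventually_elim
        case (elim k)
        have "J k \<inter> {0<..<\<alpha>} = J k \<inter> {0<..<\<delta>\<^sub>0}"
          by (rule card_seteq[OF Suc.prems(2)]) (use elim True Suc.prems(3)[of k] in auto)
        then have "y \<in> J k \<inter> {0<..<\<delta>\<^sub>0} \<Longrightarrow> y < \<alpha>" for y by auto
        then show ?case using \<alpha> by fastforce
      qed
    qed auto
    then show ?thesis
      using Suc.prems(1) by (intro exI[of _ \<delta>\<^sub>0] exI[of _ id]) (auto simp: strict_mono_def)
  qed
qed

section \<open>Behaviour for large times: monotone quantities and limit points\<close>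

text \<open>Monotonicity is asked only on a set \<open>S\<close> because \<open>S\<close> will also
  be the set of times at which one fixed parameter is active.\<close>

lemma tendsto_Inf_antimono_on:
  fixes v :: "real \<Rightarrow> real"
  assumes mono: "antimono_on S v" and bdd: "bdd_below (v ` S)"
    and T: "filterlim T at_top sequentially" and TS: "\<forall>\<^sub>F k in sequentially. T k \<in> S"
  shows "(\<lambda>k. v (T k)) \<longlonglongrightarrow> Inf (v ` S)"
proof (rule order_tendstoI)
  fix y assume "y < Inf (v ` S)"
  then show "\<forall>\<^sub>F k in sequentially. y < v (T k)"
    using TS by (elim eventually_mono) (use cINF_lower[OF bdd] in fastforce)
next
  fix y assume y: "Inf (v ` S) < y"
  have "S \<noteq> {}" using eventually_happens[OF TS] by auto
  then obtain s where s: "s \<in> S" "v s < y"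
    using y cINF_less_iff[OF _ bdd] by blast
  have "\<forall>\<^sub>F k in sequentially. s \<le> T k"
    using T by (simp add: filterlim_at_top)
  then show "\<forall>\<^sub>F k in sequentially. v (T k) < y"
    using TS
  proof eventually_elim
    case (elim k)
    then have "v (T k) \<le> v s" using mono s(1) by (auto simp: monotone_on_def)
    then show ?case using s(2) by simp
  qed
qed

text \<open>Reduces convergence to the location of limit points: times at which the distance to
  \<open>M\<close> stays above some \<open>e\<close> would, by compactness of \<open>B\<close>, have
  a subsequence whose states converge to a point of \<open>M\<close>.\<close>

lemma tends_to_setI:
  fixes x :: "real \<Rightarrow> 'a::euclidean_space"
  assumes B: "compact B" "\<And>t. t \<ge> 0 \<Longrightarrow> x t \<in> B"
    and lim: "\<And>T \<xi>. filterlim T at_top sequentially \<Longrightarrow> (\<lambda>k. x (T k)) \<longlonglongrightarrow> \<xi> \<Longrightarrow> \<xi> \<in> M"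
  shows "tends_to_set x M"
proof -
  have sub: "\<exists>\<xi> r. \<xi> \<in> M \<and> strict_mono (r :: nat \<Rightarrow> nat) \<and> (\<lambda>k. x (T (r k))) \<longlonglongrightarrow> \<xi>"
    if T: "filterlim T at_top sequentially" "\<And>k. T k \<ge> 0" for T :: "nat \<Rightarrow> real"
  proof -
    obtain \<xi> r where r: "strict_mono (r :: nat \<Rightarrow> nat)" "((\<lambda>k. x (T k)) \<circ> r) \<longlonglongrightarrow> \<xi>"
      using B(1) unfolding compact_def using B(2) T(2) by meson
    have "filterlim (\<lambda>k. T (r k)) at_top sequentially"
      using filterlim_compose[OF T(1) filterlim_subseq[OF r(1)]] .
    then show ?thesis using r lim[of "\<lambda>k. T (r k)" \<xi>] by (auto simp: o_def)
  qed
  \<comment> \<open>The times \<open>T k = k\<close> already produce a limit point.\<close>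
  have "M \<noteq> {}"
    using sub[OF filterlim_real_sequentially] by auto
  moreover have "((\<lambda>t. infdist (x t) M) \<longlongrightarrow> 0) at_top"
  proof (rule ccontr)
    assume "\<not> ?thesis"
    then obtain e where e: "e > 0" "\<not> (\<forall>\<^sub>F t in at_top. infdist (x t) M < e)"
      by (auto simp: tendsto_iff infdist_nonneg)
    then have "\<exists>t\<ge>real n. infdist (x t) M \<ge> e" for n
      unfolding eventually_at_top_linorder by (metis not_less)
    then obtain T where T: "\<And>n. T n \<ge> real n" "\<And>n. infdist (x (T n)) M \<ge> e" by metis
    have "filterlim T at_top sequentially"
      using T(1) by (intro filterlim_at_top_mono[OF filterlim_real_sequentially]) auto
    moreover have "T n \<ge> 0" for n using T(1)[of n] by simp
    ultimately obtain \<xi> r where \<xi>: "\<xi> \<in> M" "(\<lambda>k. x (T (r k))) \<longlonglongrightarrow> \<xi>" using sub by blast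
    have "\<forall>\<^sub>F k in sequentially. dist (x (T (r k))) \<xi> < e"
      using \<xi>(2) e(1) by (auto simp: tendsto_iff)
    then obtain k where "dist (x (T (r k))) \<xi> < e"
      using eventually_happens by fastforce
    then show False using infdist_le[OF \<xi>(1), of "x (T (r k))"] T(2)[of "r k"] by simp
  qed
  ultimately show ?thesis by (simp add: tends_to_set_def)
qed

section \<open>Limit arcs of a precompact trajectory\<close>

lemma switching_signal_constant_on:
  assumes "switching_signal \<Gamma> \<sigma>" "jump_times \<sigma> \<inter> {a<..<b} = {}" "a < \<alpha>" "\<beta> < b"
  shows "\<sigma> constant_on {\<alpha>..\<beta>}"
proof -
  have "\<sigma> constant_on {a<..<b}"
    using assms(1,2) by (simp add: switching_signal_def)
  then show ?thesis
    by (rule constant_on_subset) (use assms(3,4) in auto)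
qed

lemma constant_onD: "f constant_on S \<Longrightarrow> s \<in> S \<Longrightarrow> t \<in> S \<Longrightarrow> f s = f t"
  unfolding constant_on_def by metis

text \<open>What the limit argument retains of a trajectory on nonnegative times: a compact set
  \<open>B\<close> of states, the constraint set, and the increment condition in place of the
  differential equation.\<close>

locale precompact_trajectory =
  fixes \<Gamma> :: "'g::metric_space set"
    and D :: "('a::euclidean_space \<times> 'g) set"
    and f :: "'a \<times> 'g \<Rightarrow> 'a"
    and x :: "real \<Rightarrow> 'a"
    and \<sigma> :: "real \<Rightarrow> 'g"
    and B :: "'a set"
  assumes compact_\<Gamma>: "compact \<Gamma>" and closed_D: "closed D"
    and cont_f: "continuous_on D f"
    and avg_dwell: "\<sigma> \<in> signals_avg_dwell \<Gamma>"
    and compact_B: "compact B" and x_in_B: "t \<ge> 0 \<Longrightarrow> x t \<in> B"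
    and x_in_D: "t \<ge> 0 \<Longrightarrow> (x t, \<sigma> t) \<in> D"
    and incr: "increments_controlled {0..} x (\<lambda>t. f (x t, \<sigma> t))"
begin

lemma switching: "switching_signal \<Gamma> \<sigma>"
  using avg_dwell by (auto simp: signals_avg_dwell_def signals_avg_dwell_with_def)

lemma signal_in: "\<sigma> t \<in> \<Gamma>"
  using switching by (auto simp: switching_signal_def)

text \<open>Average dwell time enters the limit argument through this bound, uniform over all
  windows of length 1.\<close>

lemma card_jump_times_bounded: "\<exists>n. \<forall>s. card (jump_times \<sigma> \<inter> {s<..<s + 1}) \<le> n"
proof -
  obtain \<tau>\<^sub>D N\<^sub>0 where *: "\<tau>\<^sub>D > 0"
    "\<And>\<tau>\<^sub>1 \<tau>\<^sub>2. \<tau>\<^sub>1 < \<tau>\<^sub>2 \<Longrightarrow> real (card (jump_times \<sigma> \<inter> {\<tau>\<^sub>1<..<\<tau>\<^sub>2})) \<le> real N\<^sub>0 + (\<tau>\<^sub>2 - \<tau>\<^sub>1) / \<tau>\<^sub>D"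
    using avg_dwell by (auto simp: signals_avg_dwell_def signals_avg_dwell_with_def)
  have "card (jump_times \<sigma> \<inter> {s<..<s + 1}) \<le> nat \<lceil>real N\<^sub>0 + 1 / \<tau>\<^sub>D\<rceil>" for s
    using *(2)[of s "s + 1"] by simp linarith
  then show ?thesis by blast
qed

lemma finite_jump_times: "finite (jump_times \<sigma> \<inter> {a<..<b})"
proof -
  have "finite (jump_times \<sigma> \<inter> {a..b})"
    using switching by (simp add: switching_signal_def)
  then show ?thesis by (rule finite_subset[rotated]) auto
qed

lemma compact_D_B: "compact (D \<inter> (B \<times> \<Gamma>))"
  by (intro closed_Int_compact closed_D compact_Times compact_B compact_\<Gamma>)

lemma state_in: "t \<ge> 0 \<Longrightarrow> (x t, \<sigma> t) \<in> D \<inter> (B \<times> \<Gamma>)"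
  using x_in_B x_in_D signal_in by auto

text \<open>States and parameters stay in the compact set
  \<open>D \<inter> (B \<times> \<Gamma>)\<close>, on which the continuous \<open>f\<close> is
  bounded.\<close>

lemma x_lipschitz: obtains M where "M-lipschitz_on {0..} x"
proof -
  have "bounded (f ` (D \<inter> (B \<times> \<Gamma>)))"
    by (intro compact_imp_bounded compact_continuous_image continuous_on_subset[OF cont_f] compact_D_B) auto
  then obtain M where M: "M > 0" "\<And>p. p \<in> D \<inter> (B \<times> \<Gamma>) \<Longrightarrow> norm (f p) \<le> M"
    unfolding bounded_pos by blast
  have "M-lipschitz_on {0..} x"
    by (rule increments_controlled_lipschitz[OF incr])
      (use M state_in in \<open>auto simp: is_interval_ci\<close>)
  then show ?thesis by (rule that)
qed

text \<open>
  The signal converges only on the open interval, because jumps may accumulate at the endpoints.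
\<close>

definition limit_arc :: "(nat \<Rightarrow> real) \<Rightarrow> real \<Rightarrow> real \<Rightarrow> 'g \<Rightarrow> (real \<Rightarrow> 'a) \<Rightarrow> bool" where
  "limit_arc T a b \<gamma> \<phi> \<longleftrightarrow>
     a < b \<and> \<gamma> \<in> \<Gamma> \<and> filterlim T at_top sequentially \<and>
     (\<exists>M. M-lipschitz_on {a..b} \<phi>) \<and>
     (\<forall>t\<in>{a..b}. \<phi> t \<in> B \<and> (\<phi> t, \<gamma>) \<in> D \<and>
        (\<phi> has_vector_derivative f (\<phi> t, \<gamma>)) (at t within {a..b}) \<and>
        (\<lambda>k. x (T k + t)) \<longlonglongrightarrow> \<phi> t) \<and>
     (\<forall>t\<in>{a<..<b}. (\<lambda>k. \<sigma> (T k + t)) \<longlonglongrightarrow> \<gamma>) \<and>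
     (\<forall>\<alpha> \<beta>. a < \<alpha> \<longrightarrow> \<beta> < b \<longrightarrow> (\<forall>\<^sub>F k in sequentially. \<sigma> constant_on {T k + \<alpha>..T k + \<beta>}))"

lemma limit_arcD:
  assumes "limit_arc T a b \<gamma> \<phi>"
  shows "a < b" and "\<gamma> \<in> \<Gamma>" and "filterlim T at_top sequentially"
    and "\<exists>M. M-lipschitz_on {a..b} \<phi>"
    and "t \<in> {a..b} \<Longrightarrow> \<phi> t \<in> B"
    and "t \<in> {a..b} \<Longrightarrow> (\<phi> t, \<gamma>) \<in> D"
    and "t \<in> {a..b} \<Longrightarrow> (\<phi> has_vector_derivative f (\<phi> t, \<gamma>)) (at t within {a..b})"
    and "t \<in> {a..b} \<Longrightarrow> (\<lambda>k. x (T k + t)) \<longlonglongrightarrow> \<phi> t"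
    and "t \<in> {a<..<b} \<Longrightarrow> (\<lambda>k. \<sigma> (T k + t)) \<longlonglongrightarrow> \<gamma>"
    and "a < \<alpha> \<Longrightarrow> \<beta> < b \<Longrightarrow> \<forall>\<^sub>F k in sequentially. \<sigma> constant_on {T k + \<alpha>..T k + \<beta>}"
  using assms by (simp_all add: limit_arc_def)

text \<open>Arzela-Ascoli yields a limit of the shifted states, compactness of \<Gamma> one of the
  signal, and \<open>limit_solution\<close> identifies the equation. The constancy hypothesis is
  what the analysis of jumps must deliver.\<close>

lemma limit_arc_exists:
  assumes T: "filterlim T at_top sequentially" and ab: "a < b"
    and const: "\<And>\<alpha> \<beta>. a < \<alpha> \<Longrightarrow> \<beta> < b \<Longrightarrow> \<forall>\<^sub>F k in sequentially. \<sigma> constant_on {T k + \<alpha>..T k + \<beta>}"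
  obtains r \<gamma> \<phi> where "strict_mono r" "limit_arc (\<lambda>k. T (r k)) a b \<gamma> \<phi>"
proof -
  obtain M where lip: "M-lipschitz_on {0..} x" by (rule x_lipschitz)
  then have M: "M \<ge> 0" by (rule lipschitz_on_nonneg)
  define y where "y t = x (max 0 t)" for t
    \<comment> \<open>frozen before time 0, so that all shifts are equi-Lipschitz on the whole line\<close>
  have lip_y: "dist (y s) (y t) \<le> M * dist s t" for s t
  proof -
    have "dist (y s) (y t) \<le> M * dist (max 0 s) (max 0 t)"
      unfolding y_def by (rule lipschitz_onD[OF lip]) auto
    also have "\<dots> \<le> M * dist s t"
      using M by (intro mult_left_mono) (auto simp: dist_real_def)
    finally show ?thesis .
  qed
  obtain C where C: "\<And>z. z \<in> B \<Longrightarrow> norm z \<le> C"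
    using compact_imp_bounded[OF compact_B] unfolding bounded_iff by blast
  have y_bd: "norm (y (T n + t)) \<le> C" for n t
    using C x_in_B by (simp add: y_def)
  have equi: "\<exists>d>0. \<forall>n s. s \<in> {a..b} \<and> norm (t - s) < d \<longrightarrow> norm (y (T n + t) - y (T n + s)) < e"
    if "t \<in> {a..b}" "0 < e" for t e
  proof (intro exI[of _ "e / (M + 1)"] conjI allI impI)
    show "e / (M + 1) > 0" using M that by simp
    fix n s assume s: "s \<in> {a..b} \<and> norm (t - s) < e / (M + 1)"
    have "norm (y (T n + t) - y (T n + s)) \<le> M * norm (t - s)"
      using lip_y[of "T n + t" "T n + s"] by (simp add: dist_norm)
    also have "\<dots> \<le> M * (e / (M + 1))" using s M by (intro mult_left_mono) auto
    also have "\<dots> < e" using M that by (simp add: field_simps)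
    finally show "norm (y (T n + t) - y (T n + s)) < e" .
  qed
  obtain \<phi> r where r: "strict_mono (r :: nat \<Rightarrow> nat)" and
    \<phi>: "\<And>e. 0 < e \<Longrightarrow> \<exists>N. \<forall>n t. n \<ge> N \<and> t \<in> {a..b} \<longrightarrow> norm (y (T (r n) + t) - \<phi> t) < e"
    using Arzela_Ascoli[of "{a..b}" "\<lambda>n t. y (T n + t)" C] y_bd equi compact_Icc by (metis (no_types, lifting))
  \<comment> \<open>Convergence of the signal at the midpoint alone, combined with eventual
    constancy, gives uniform convergence on compact parts of the open interval.\<close>
  define m where "m = (a + b) / 2"
  have m: "a < m" "m < b" using ab by (auto simp: m_def)
  obtain \<gamma> r' where r': "strict_mono (r' :: nat \<Rightarrow> nat)" and \<gamma>: "\<gamma> \<in> \<Gamma>"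
    and lim_m: "((\<lambda>k. \<sigma> (T (r k) + m)) \<circ> r') \<longlonglongrightarrow> \<gamma>"
    using compact_\<Gamma> signal_in unfolding compact_def by meson
  define R where "R k = T (r (r' k))" for k
  have rr: "strict_mono (\<lambda>k. r (r' k))" using r r' by (auto simp: strict_mono_def)
  have R: "filterlim R at_top sequentially"
    unfolding R_def using filterlim_compose[OF T filterlim_subseq[OF rr]] .
  \<comment> \<open>For such \<open>k\<close> the time \<open>R k + t\<close> is nonnegative for all
    t in \<open>{a..b}\<close>, so there \<open>y\<close> coincides with \<open>x\<close>.\<close>
  have Rpos: "\<forall>\<^sub>F k in sequentially. R k \<ge> - a"
    using R by (simp add: filterlim_at_top)
  have const': "\<forall>\<^sub>F k in sequentially. \<sigma> constant_on {R k + \<alpha>..R k + \<beta>}" if "a < \<alpha>" "\<beta> < b" for \<alpha> \<beta>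
    unfolding R_def using eventually_subseq[OF rr const[OF that]] .
  have limy: "(\<lambda>k. y (R k + t)) \<longlonglongrightarrow> \<phi> t" if t: "t \<in> {a..b}" for t
  proof -
    have "(\<lambda>n. y (T (r n) + t)) \<longlonglongrightarrow> \<phi> t"
      unfolding LIMSEQ_iff using \<phi> t by meson
    from LIMSEQ_subseq_LIMSEQ[OF this r'] show ?thesis by (simp add: R_def o_def)
  qed
  have yx: "\<forall>\<^sub>F k in sequentially. \<forall>t\<in>{a..b}. y (R k + t) = x (R k + t)"
    using Rpos by eventually_elim (auto simp: y_def)
  have limx: "(\<lambda>k. x (R k + t)) \<longlonglongrightarrow> \<phi> t" if t: "t \<in> {a..b}" for t
    by (rule Lim_transform_eventually[OF limy[OF t]]) (use yx t in \<open>auto elim: eventually_mono\<close>)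
  have unif: "uniform_limit {\<alpha>..\<beta>} (\<lambda>k t. \<sigma> (R k + t)) (\<lambda>_. \<gamma>) sequentially"
    if "a < \<alpha>" "\<alpha> < \<beta>" "\<beta> < b" for \<alpha> \<beta>
    unfolding uniform_limit_iff
  proof (intro allI impI)
    fix e :: real assume "e > 0"
    then have "\<forall>\<^sub>F k in sequentially. dist (\<sigma> (R k + m)) \<gamma> < e"
      using lim_m by (auto simp: tendsto_iff R_def)
    \<comment> \<open>The interval is enlarged to contain \<open>m\<close>, so that the signal on
      \<open>{\<alpha>..\<beta>}\<close> has its midpoint value.\<close>
    moreover have "\<forall>\<^sub>F k in sequentially. \<sigma> constant_on {R k + min \<alpha> m..R k + max \<beta> m}"
      using that m by (intro const') auto
    ultimately show "\<forall>\<^sub>F k in sequentially. \<forall>t\<in>{\<alpha>..\<beta>}. dist (\<sigma> (R k + t)) \<gamma> < e"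
    proof eventually_elim
      case (elim k)
      show ?case
      proof
        fix t assume "t \<in> {\<alpha>..\<beta>}"
        then have "\<sigma> (R k + t) = \<sigma> (R k + m)"
          by (intro constant_onD[OF elim(2)]) auto
        then show "dist (\<sigma> (R k + t)) \<gamma> < e" using elim(1) by simp
      qed
    qed
  qed
  have lip_u: "\<forall>\<^sub>F k in sequentially. M-lipschitz_on {a..b} (\<lambda>t. x (R k + t))"
    using Rpos
  proof eventually_elim
    case (elim k)
    show ?case
    proof (rule lipschitz_onI)
      fix s t assume "s \<in> {a..b}" "t \<in> {a..b}"
      then show "dist (x (R k + s)) (x (R k + t)) \<le> M * dist s t"
        using lipschitz_onD[OF lip, of "R k + s" "R k + t"] elim by auto
    qed (rule M)
  qed
  have incr_u: "\<forall>\<^sub>F k in sequentially.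
      increments_controlled {a..b} (\<lambda>t. x (R k + t)) (\<lambda>t. f (x (R k + t), \<sigma> (R k + t)))"
    using Rpos
    by eventually_elim (rule increments_controlled_shift[OF incr], auto)
  have mem_u: "\<forall>\<^sub>F k in sequentially. \<forall>t\<in>{a..b}. (x (R k + t), \<sigma> (R k + t)) \<in> D"
    using Rpos by eventually_elim (auto intro!: x_in_D)
  note sol = limit_solution[OF ab closed_D cont_f lip_u incr_u mem_u limx unif]
  have in_B: "\<phi> t \<in> B" if t: "t \<in> {a..b}" for t
    by (rule Lim_in_closed_set[OF compact_imp_closed[OF compact_B] _ _ limy[OF t]])
      (auto simp: y_def x_in_B)
  have lim\<sigma>: "(\<lambda>k. \<sigma> (R k + t)) \<longlonglongrightarrow> \<gamma>" if t: "t \<in> {a<..<b}" for t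
  proof -
    obtain \<alpha> \<beta> where "a < \<alpha>" "\<alpha> < t" "t < \<beta>" "\<beta> < b"
      using t dense by (metis greaterThanLessThan_iff)
    then show ?thesis
      using tendsto_uniform_limitI[OF unif[of \<alpha> \<beta>], of t] by auto
  qed
  have "limit_arc R a b \<gamma> \<phi>"
    unfolding limit_arc_def
    using ab \<gamma> R lipschitz_on_limit_seq[OF lip_u limx] in_B sol limx lim\<sigma> const' by blast
  then show ?thesis
    using that[OF rr] by (simp add: R_def[abs_def])
qed

section \<open>Arcs leaving and reaching a limit point\<close>

text \<open>Counted from \<open>T k\<close>, at most \<open>n\<close> jumps fall into
  \<open>{0<..<1}\<close>, uniformly in \<open>k\<close>. Hence \<open>jump_free_subsequence\<close>
  applies and supplies the constancy that \<open>limit_arc_exists\<close> asks for.\<close>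

lemma limit_point_forward_arc:
  assumes T: "filterlim T at_top sequentially" and \<xi>: "(\<lambda>k. x (T k)) \<longlonglongrightarrow> \<xi>"
  obtains R \<delta> \<gamma> \<phi> where "\<delta> > 0" "limit_arc R 0 \<delta> \<gamma> \<phi>" "\<phi> 0 = \<xi>"
proof -
  obtain n where n: "\<And>s. card (jump_times \<sigma> \<inter> {s<..<s + 1}) \<le> n"
    using card_jump_times_bounded by blast
  define J where "J k = {t. T k + t \<in> jump_times \<sigma>}" for k
  have img: "jump_times \<sigma> \<inter> {T k + \<alpha><..<T k + \<beta>} = (\<lambda>t. T k + t) ` (J k \<inter> {\<alpha><..<\<beta>})" for k \<alpha> \<beta>
  proof (intro subset_antisym subsetI)
    fix t assume "t \<in> jump_times \<sigma> \<inter> {T k + \<alpha><..<T k + \<beta>}"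
    then show "t \<in> (\<lambda>t. T k + t) ` (J k \<inter> {\<alpha><..<\<beta>})"
      by (intro image_eqI[of _ _ "t - T k"]) (auto simp: J_def)
  qed (auto simp: J_def)
  have "finite (J k \<inter> {0<..<1})" "card (J k \<inter> {0<..<1}) \<le> n" for k
  proof -
    have "inj_on (\<lambda>t. T k + t) (J k \<inter> {0<..<1})" by (auto simp: inj_on_def)
    then show "finite (J k \<inter> {0<..<1})" "card (J k \<inter> {0<..<1}) \<le> n"
      using finite_jump_times[of "T k" "T k + 1"] n[of "T k"] img[of k 0 1]
      by (auto simp: card_image dest: finite_imageD)
  qed
  then obtain \<delta> r where \<delta>: "0 < \<delta>" "strict_mono (r :: nat \<Rightarrow> nat)"
    "\<And>\<alpha>. \<alpha> > 0 \<Longrightarrow> \<forall>\<^sub>F k in sequentially. J (r k) \<inter> {\<alpha><..<\<delta>} = {}"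
    using jump_free_subsequence[of 1 J n] by auto
  have "\<forall>\<^sub>F k in sequentially. \<sigma> constant_on {T (r k) + \<alpha>..T (r k) + \<beta>}"
    if "0 < \<alpha>" "\<beta> < \<delta>" for \<alpha> \<beta>
  proof -
    \<comment> \<open>Halving \<alpha> leaves room: the jump-free open interval has to contain the
      closed interval that starts at \<alpha>.\<close>
    have "\<forall>\<^sub>F k in sequentially. J (r k) \<inter> {\<alpha> / 2<..<\<delta>} = {}" using that by (intro \<delta>(3)) auto
    then show ?thesis
    proof eventually_elim
      case (elim k)
      then have "jump_times \<sigma> \<inter> {T (r k) + \<alpha> / 2<..<T (r k) + \<delta>} = {}"
        unfolding img by simp
      then show ?case
        by (rule switching_signal_constant_on[OF switching]) (use that in auto)
    qed
  qed
  then obtain r' \<gamma> \<phi> where r': "strict_mono (r' :: nat \<Rightarrow> nat)" and arc: "limit_arc (\<lambda>k. T (r (r' k))) 0 \<delta> \<gamma> \<phi>"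
    using limit_arc_exists[OF filterlim_compose[OF T filterlim_subseq[OF \<delta>(2)]] \<delta>(1)] by blast
  have "(\<lambda>k. x (T (r (r' k)))) \<longlonglongrightarrow> \<phi> 0"
    using limit_arcD(8)[OF arc, of 0] \<delta>(1) by simp
  moreover have "(\<lambda>k. x (T (r (r' k)))) \<longlonglongrightarrow> \<xi>"
    using LIMSEQ_subseq_LIMSEQ[OF \<xi> strict_mono_o[OF \<delta>(2) r']] by (simp add: o_def)
  ultimately have "\<phi> 0 = \<xi>" by (auto intro: LIMSEQ_unique)
  then show ?thesis using that[OF \<delta>(1) arc] by blast
qed

text \<open>Measuring jumps backwards from \<open>T k\<close> reflects the left neighbourhood to the
  right of 0, where \<open>jump_free_subsequence\<close> applies as before.\<close>

lemma limit_point_backward_arc: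
  assumes T: "filterlim T at_top sequentially" and \<xi>: "(\<lambda>k. x (T k)) \<longlonglongrightarrow> \<xi>"
  obtains R \<delta> \<gamma> \<phi> where "\<delta> > 0" "limit_arc R (- \<delta>) 0 \<gamma> \<phi>" "\<phi> 0 = \<xi>"
proof -
  obtain n where n: "\<And>s. card (jump_times \<sigma> \<inter> {s<..<s + 1}) \<le> n"
    using card_jump_times_bounded by blast
  define J where "J k = {t. T k - t \<in> jump_times \<sigma>}" for k
  have img: "jump_times \<sigma> \<inter> {T k - \<beta><..<T k - \<alpha>} = (\<lambda>t. T k - t) ` (J k \<inter> {\<alpha><..<\<beta>})" for k \<alpha> \<beta>
  proof (intro subset_antisym subsetI)
    fix t assume "t \<in> jump_times \<sigma> \<inter> {T k - \<beta><..<T k - \<alpha>}"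
    then show "t \<in> (\<lambda>t. T k - t) ` (J k \<inter> {\<alpha><..<\<beta>})"
      by (intro image_eqI[of _ _ "T k - t"]) (auto simp: J_def)
  qed (auto simp: J_def)
  have "finite (J k \<inter> {0<..<1})" "card (J k \<inter> {0<..<1}) \<le> n" for k
  proof -
    have "inj_on (\<lambda>t. T k - t) (J k \<inter> {0<..<1})" by (auto simp: inj_on_def)
    then show "finite (J k \<inter> {0<..<1})" "card (J k \<inter> {0<..<1}) \<le> n"
      using finite_jump_times[of "T k - 1" "T k"] n[of "T k - 1"] img[of k 1 0]
      by (auto simp: card_image dest: finite_imageD)
  qed
  then obtain \<delta> r where \<delta>: "0 < \<delta>" "strict_mono (r :: nat \<Rightarrow> nat)"
    "\<And>\<alpha>. \<alpha> > 0 \<Longrightarrow> \<forall>\<^sub>F k in sequentially. J (r k) \<inter> {\<alpha><..<\<delta>} = {}"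
    using jump_free_subsequence[of 1 J n] by auto
  have "\<forall>\<^sub>F k in sequentially. \<sigma> constant_on {T (r k) + \<alpha>..T (r k) + \<beta>}"
    if "- \<delta> < \<alpha>" "\<beta> < 0" for \<alpha> \<beta>
  proof -
    have "\<forall>\<^sub>F k in sequentially. J (r k) \<inter> {- \<beta> / 2<..<\<delta>} = {}" using that by (intro \<delta>(3)) auto
    then show ?thesis
    proof eventually_elim
      case (elim k)
      then have "jump_times \<sigma> \<inter> {T (r k) - \<delta><..<T (r k) - (- \<beta> / 2)} = {}"
        unfolding img by simp
      then show ?case
        by (rule switching_signal_constant_on[OF switching]) (use that in auto)
    qed
  qed
  moreover have "- \<delta> < 0" using \<delta>(1) by simp
  ultimately obtain r' \<gamma> \<phi> where r': "strict_mono (r' :: nat \<Rightarrow> nat)" and arc: "limit_arc (\<lambda>k. T (r (r' k))) (- \<delta>) 0 \<gamma> \<phi>"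
    using limit_arc_exists[OF filterlim_compose[OF T filterlim_subseq[OF \<delta>(2)]]] by blast
  have "(\<lambda>k. x (T (r (r' k)))) \<longlonglongrightarrow> \<phi> 0"
    using limit_arcD(8)[OF arc, of 0] \<delta>(1) by simp
  moreover have "(\<lambda>k. x (T (r (r' k)))) \<longlonglongrightarrow> \<xi>"
    using LIMSEQ_subseq_LIMSEQ[OF \<xi> strict_mono_o[OF \<delta>(2) r']] by (simp add: o_def)
  ultimately have "\<phi> 0 = \<xi>" by (auto intro: LIMSEQ_unique)
  then show ?thesis using that[OF \<delta>(1) arc] by blast
qed

end

section \<open>Dissipation along limit arcs\<close>

lemma filterlim_at_top_add_const:
  fixes T :: "'b \<Rightarrow> real"
  assumes "filterlim T at_top F"
  shows "filterlim (\<lambda>k. T k + s) at_top F"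
  using filterlim_tendsto_add_at_top[OF tendsto_const assms, of s] by (simp add: add.commute)

text \<open>The vector \<open>adjoint F' 1\<close> represents the derivative by the inner product,
  and uniqueness of the derivative makes the description in \<open>grad\<close> proper.\<close>

lemma GDERIV_grad:
  fixes F :: "'a::euclidean_space \<Rightarrow> real"
  assumes "F differentiable (at \<xi>)"
  shows "GDERIV F \<xi> :> grad F \<xi>"
proof -
  obtain F' where F': "(F has_derivative F') (at \<xi>)"
    using assms by (auto simp: differentiable_def)
  then have lin: "linear F'" by (rule has_derivative_linear)
  have "F' = (\<lambda>h. h \<bullet> adjoint F' 1)"
    using adjoint_works[OF lin, of _ 1] by (simp add: fun_eq_iff)
  then have ex: "GDERIV F \<xi> :> adjoint F' 1"
    using F' by (simp add: gderiv_def)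
  have "D = adjoint F' 1" if "GDERIV F \<xi> :> D" for D
    using has_derivative_unique[OF that[unfolded gderiv_def] ex[unfolded gderiv_def]]
    by (metis vector_eq_rdot inner_commute)
  then show ?thesis
    unfolding grad_def using ex by (rule theI[where P="\<lambda>D. GDERIV F \<xi> :> D", rotated])
qed

text \<open>Chain rule followed by the dissipation inequality. The derivative is taken within
  \<open>S\<close>, so that endpoints of closed intervals are included.\<close>

lemma derivative_along_solution_le:
  fixes \<phi> :: "real \<Rightarrow> 'a::euclidean_space"
  assumes V: "class_V \<Gamma> domf domV V" "decrease_condition \<Gamma> domf f domV V W"
    and \<gamma>: "\<gamma> \<in> \<Gamma>" and mem: "\<phi> t \<in> base_at domf domV \<gamma>"
    and der: "(\<phi> has_vector_derivative f (\<phi> t, \<gamma>)) (at t within S)"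
  shows "\<exists>d. ((\<lambda>t. V (\<phi> t, \<gamma>)) has_real_derivative d) (at t within S) \<and> d \<le> - W \<gamma> (\<phi> t)"
proof -
  have "GDERIV (\<lambda>\<xi>. V (\<xi>, \<gamma>)) (\<phi> t) :> grad (\<lambda>\<xi>. V (\<xi>, \<gamma>)) (\<phi> t)"
    using V(1) \<gamma> mem by (intro GDERIV_grad) (simp add: class_V_def)
  then have "((\<lambda>t. V (\<phi> t, \<gamma>)) has_derivative
      (\<lambda>h. (h *\<^sub>R f (\<phi> t, \<gamma>)) \<bullet> grad (\<lambda>\<xi>. V (\<xi>, \<gamma>)) (\<phi> t))) (at t within S)"
    using has_derivative_compose[OF der[unfolded has_vector_derivative_def]]
    unfolding gderiv_def by blast
  then have "((\<lambda>t. V (\<phi> t, \<gamma>)) has_real_derivative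
      grad (\<lambda>\<xi>. V (\<xi>, \<gamma>)) (\<phi> t) \<bullet> f (\<phi> t, \<gamma>)) (at t within S)"
    by (simp add: has_field_derivative_def inner_commute mult.commute mult_commute_abs)
  moreover have "grad (\<lambda>\<xi>. V (\<xi>, \<gamma>)) (\<phi> t) \<bullet> f (\<phi> t, \<gamma>) \<le> - W \<gamma> (\<phi> t)"
    using V(2) \<gamma> mem by (fastforce simp: decrease_condition_def)
  ultimately show ?thesis by blast
qed

lemma decrease_condition_nonneg:
  "decrease_condition \<Gamma> domf f domV V W \<Longrightarrow> \<gamma> \<in> \<Gamma> \<Longrightarrow> \<xi> \<in> base_at domf domV \<gamma> \<Longrightarrow> 0 \<le> W \<gamma> \<xi>"
  by (simp add: decrease_condition_def)

context precompact_trajectory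
begin

text \<open>Applying \<open>limit_solution\<close> to a constant sequence upgrades the increment
  condition to differentiability at every time of an interval on which the signal is
  constant.\<close>

lemma has_vector_derivative_between_jumps:
  assumes "0 \<le> p" "p < q" and \<sigma>: "\<And>t. t \<in> {p..q} \<Longrightarrow> \<sigma> t = \<gamma>" and t: "t \<in> {p..q}"
  shows "(x has_vector_derivative f (x t, \<gamma>)) (at t within {p..q})"
proof -
  obtain M where lip: "M-lipschitz_on {0..} x" by (rule x_lipschitz)
  show ?thesis
  proof (rule limit_solution(2)[OF assms(2) closed_D cont_f, where u="\<lambda>_. x" and s="\<lambda>_. \<sigma>"])
    show "\<forall>\<^sub>F k in sequentially. M-lipschitz_on {p..q} x"
      using lipschitz_on_subset[OF lip] assms(1) by (intro always_eventually) auto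
    show "\<forall>\<^sub>F k in sequentially. increments_controlled {p..q} x (\<lambda>t. f (x t, \<sigma> t))"
      using increments_controlled_subset[OF incr] assms(1) by (intro always_eventually) auto
    show "\<forall>\<^sub>F k in sequentially. \<forall>t\<in>{p..q}. (x t, \<sigma> t) \<in> D"
      using x_in_D assms(1) by (intro always_eventually) auto
    show "uniform_limit {\<alpha>..\<beta>} (\<lambda>_. \<sigma>) (\<lambda>_. \<gamma>) sequentially" if "p < \<alpha>" "\<beta> < q" for \<alpha> \<beta>
      unfolding uniform_limit_iff using \<sigma> that by auto
  qed (use t in auto)
qed

lemma limit_arc_base_at:
  assumes "limit_arc T a b \<gamma> \<phi>" "B \<subseteq> base domV" "t \<in> {a..b}"
  shows "\<phi> t \<in> base_at D domV \<gamma>"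
  using limit_arcD(5,6)[OF assms(1,3)] assms(2) by (auto simp: base_at_def fiber_def)

lemma limit_arc_solution_on:
  assumes arc: "limit_arc T a b \<gamma> \<phi>" and "B \<subseteq> base domV"
  shows "solution_on {a..b} (\<lambda>_. base_at D domV \<gamma>) (\<lambda>_ \<xi>. f (\<xi>, \<gamma>)) \<phi>"
proof -
  obtain M where "M-lipschitz_on {a..b} \<phi>" using limit_arcD(4)[OF arc] by blast
  then have "locally_absolutely_cont_on {a..b} \<phi>"
    by (rule lipschitz_on_imp_locally_absolutely_cont_on)
  then show ?thesis
    using limit_arcD(1)[OF arc] limit_arc_base_at[OF assms] limit_arcD(7)[OF arc]
    by (auto simp: solution_on_def is_interval_cc)
qed

section \<open>Convergence to the observability-like sets\<close>

text \<open>A limit point starts one limit arc and ends another, possibly with a different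
  parameter; if \<open>W\<close> vanishes along both, it lies in a forward and in a backward set.
  \<open>L\<close> stands for the level sets, or for \<open>UNIV\<close> when no level is
  claimed.\<close>

lemma tends_to_observability_set:
  assumes BV: "B \<subseteq> base domV"
    and arcs: "\<And>T a b \<gamma> \<phi> t. limit_arc T a b \<gamma> \<phi> \<Longrightarrow> t \<in> {a..b} \<Longrightarrow> W \<gamma> (\<phi> t) = 0 \<and> \<phi> t \<in> L \<gamma>"
  shows "tends_to_set x (\<Union>\<gamma>\<in>\<Gamma>. \<Union>\<gamma>'\<in>\<Gamma>.
    obs_fwd_at D f domV W \<gamma> \<inter> obs_bwd_at D f domV W \<gamma>' \<inter> L \<gamma> \<inter> L \<gamma>')"
proof (rule tends_to_setI[OF compact_B x_in_B])
  fix T \<xi> assume T: "filterlim T at_top sequentially" "(\<lambda>k. x (T k)) \<longlonglongrightarrow> \<xi>"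
  obtain R \<delta> \<gamma> \<phi> where fwd: "\<delta> > 0" "limit_arc R 0 \<delta> \<gamma> \<phi>" "\<phi> 0 = \<xi>"
    using limit_point_forward_arc[OF T] .
  have "\<xi> \<in> obs_fwd_at D f domV W \<gamma> \<inter> L \<gamma>"
    using limit_arc_base_at[OF fwd(2) BV, of 0] limit_arc_solution_on[OF fwd(2) BV]
      arcs[OF fwd(2)] fwd(1,3)
    by (fastforce simp: obs_fwd_at_def obs_fwd_def obs_fwd_horizon_def)
  moreover have "\<gamma> \<in> \<Gamma>" using limit_arcD(2)[OF fwd(2)] .
  obtain R' \<delta>' \<gamma>' \<phi>' where bwd: "\<delta>' > 0" "limit_arc R' (- \<delta>') 0 \<gamma>' \<phi>'" "\<phi>' 0 = \<xi>"
    using limit_point_backward_arc[OF T] .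
  have "\<xi> \<in> obs_bwd_at D f domV W \<gamma>' \<inter> L \<gamma>'"
    using limit_arc_base_at[OF bwd(2) BV, of 0] limit_arc_solution_on[OF bwd(2) BV]
      arcs[OF bwd(2)] bwd(1,3)
    by (fastforce simp: obs_bwd_at_def obs_bwd_def obs_bwd_horizon_def)
  moreover have "\<gamma>' \<in> \<Gamma>" using limit_arcD(2)[OF bwd(2)] .
  ultimately show "\<xi> \<in> (\<Union>\<gamma>\<in>\<Gamma>. \<Union>\<gamma>'\<in>\<Gamma>.
      obs_fwd_at D f domV W \<gamma> \<inter> obs_bwd_at D f domV W \<gamma>' \<inter> L \<gamma> \<inter> L \<gamma>')"
    using \<open>\<gamma> \<in> \<Gamma>\<close> by blast
qed

text \<open>Common core of the first and third claims: they differ only in why \<open>V\<close> has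
  a fixed value at joint limits of state and signal, and in whether this value depends on the
  parameter.\<close>

lemma tends_to_level_set:
  assumes V: "class_V \<Gamma> D domV V" "decrease_condition \<Gamma> D f domV V W" and BV: "B \<subseteq> base domV"
    and lim: "\<And>T \<eta> \<gamma>. filterlim T at_top sequentially \<Longrightarrow> (\<lambda>k. x (T k)) \<longlonglongrightarrow> \<eta> \<Longrightarrow>
      (\<lambda>k. \<sigma> (T k)) \<longlonglongrightarrow> \<gamma> \<Longrightarrow> \<gamma> \<in> \<Gamma> \<Longrightarrow> \<eta> \<in> base_at D domV \<gamma> \<Longrightarrow> \<eta> \<in> B \<Longrightarrow> V (\<eta>, \<gamma>) = c \<gamma>"
  shows "tends_to_set x (\<Union>\<gamma>\<in>\<Gamma>. \<Union>\<gamma>'\<in>\<Gamma>.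
    obs_fwd_at D f domV W \<gamma> \<inter> obs_bwd_at D f domV W \<gamma>' \<inter>
    level_set domV V \<gamma> (c \<gamma>) \<inter> level_set domV V \<gamma>' (c \<gamma>'))"
proof (rule tends_to_observability_set[OF BV])
  fix T a b \<gamma> \<phi> t assume arc: "limit_arc T a b \<gamma> \<phi>" and t: "t \<in> {a..b}"
  note ab = limit_arcD(1)[OF arc] and \<gamma> = limit_arcD(2)[OF arc]
  note mem = limit_arc_base_at[OF arc BV]
  have der: "\<exists>d. ((\<lambda>t. V (\<phi> t, \<gamma>)) has_real_derivative d) (at s within {a..b}) \<and> d \<le> - W \<gamma> (\<phi> s)"
    if "s \<in> {a..b}" for s
    using that by (intro derivative_along_solution_le[OF V \<gamma>] mem limit_arcD(7)[OF arc])
  \<comment> \<open>The signal converges at interior times only, so \<open>lim\<close> is used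
    there; continuity of \<open>V\<close> along \<phi> then carries the value to both ends.\<close>
  have "V (\<phi> s, \<gamma>) = c \<gamma>" if s: "s \<in> {a<..<b}" for s
  proof (rule lim)
    show "filterlim (\<lambda>k. T k + s) at_top sequentially"
      using limit_arcD(3)[OF arc] by (rule filterlim_at_top_add_const)
    show "(\<lambda>k. x (T k + s)) \<longlonglongrightarrow> \<phi> s" using limit_arcD(8)[OF arc] s by simp
    show "(\<lambda>k. \<sigma> (T k + s)) \<longlonglongrightarrow> \<gamma>" using limit_arcD(9)[OF arc s] .
    show "\<phi> s \<in> base_at D domV \<gamma>" "\<phi> s \<in> B" using mem limit_arcD(5)[OF arc] s by auto
  qed (rule \<gamma>)
  moreover have "continuous_on {a..b} (\<lambda>t. V (\<phi> t, \<gamma>))"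
    unfolding continuous_on_eq_continuous_within using der DERIV_continuous by blast
  ultimately have eq: "V (\<phi> s, \<gamma>) = c \<gamma>" if "s \<in> {a..b}" for s
    using continuous_constant_on_closure[of "{a<..<b}" "\<lambda>t. V (\<phi> t, \<gamma>)" "c \<gamma>" s] ab that by auto
  obtain d where d: "((\<lambda>t. V (\<phi> t, \<gamma>)) has_real_derivative d) (at t within {a..b})" "d \<le> - W \<gamma> (\<phi> t)"
    using der[OF t] by blast
  \<comment> \<open>Derivatives within a nondegenerate closed interval are unique even at its ends,
    so d = 0 and the inequality for \<open>d\<close> squeezes \<open>W\<close>.\<close>
  have "((\<lambda>t. V (\<phi> t, \<gamma>)) has_vector_derivative 0) (at t within {a..b})"
    by (rule has_vector_derivative_transform[OF t _ has_vector_derivative_const[of "c \<gamma>"]]) (simp add: eq)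
  then have "d = 0"
    using d(1) ab t vector_derivative_unique_within_closed_interval[of a b t]
    unfolding has_real_derivative_iff_has_vector_derivative by auto
  then have "W \<gamma> (\<phi> t) = 0"
    using d(2) decrease_condition_nonneg[OF V(2) \<gamma> mem[OF t]] by simp
  moreover have "\<phi> t \<in> fiber domV \<gamma>"
    using V(1) \<gamma> mem[OF t] by (auto simp: class_V_def)
  ultimately show "W \<gamma> (\<phi> t) = 0 \<and> \<phi> t \<in> level_set domV V \<gamma> (c \<gamma>)"
    using eq[OF t] by (simp add: level_set_def)
qed

lemma D_B_subset: "B \<subseteq> base domV \<Longrightarrow> D \<inter> (B \<times> \<Gamma>) \<subseteq> D \<inter> (base domV \<times> \<Gamma>)"
  by auto

lemma bdd_below_along:
  fixes V :: "'a \<times> 'g \<Rightarrow> real"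
  assumes "bounded (V ` (D \<inter> (B \<times> \<Gamma>)))"
  shows "bdd_below ((\<lambda>t. V (x t, \<sigma> t)) ` {0..})"
proof -
  have "(\<lambda>t. V (x t, \<sigma> t)) ` {0..} \<subseteq> V ` (D \<inter> (B \<times> \<Gamma>))"
    using state_in by blast
  then show ?thesis
    by (rule bdd_below_mono[OF bounded_imp_bdd_below[OF assms]])
qed

text \<open>Along any times tending to infinity, \<open>v\<close> converges to its infimum by
  monotonicity and to the value of \<open>V\<close> at the joint limit by continuity. The infimum is
  therefore the common level.\<close>

lemma tends_to_common_level_set:
  assumes V: "class_V \<Gamma> D domV V" "decrease_condition \<Gamma> D f domV V W" and BV: "B \<subseteq> base domV"
    and cont: "continuous_on (D \<inter> (base domV \<times> \<Gamma>)) V"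
    and mono: "antimono_on {0..} (\<lambda>t. V (x t, \<sigma> t))"
  shows "\<exists>c. tends_to_set x (\<Union>\<gamma>\<in>\<Gamma>. \<Union>\<gamma>'\<in>\<Gamma>.
    obs_fwd_at D f domV W \<gamma> \<inter> obs_bwd_at D f domV W \<gamma>' \<inter>
    level_set domV V \<gamma> c \<inter> level_set domV V \<gamma>' c)"
proof -
  let ?v = "\<lambda>t. V (x t, \<sigma> t)"
  have contB: "continuous_on (D \<inter> (B \<times> \<Gamma>)) V"
    using cont D_B_subset[OF BV] by (rule continuous_on_subset)
  have bdd: "bdd_below (?v ` {0..})"
    by (intro bdd_below_along compact_imp_bounded compact_continuous_image contB compact_D_B)
  have "V (\<eta>, \<gamma>) = Inf (?v ` {0..})"
    if T: "filterlim T at_top sequentially" and lims: "(\<lambda>k. x (T k)) \<longlonglongrightarrow> \<eta>" "(\<lambda>k. \<sigma> (T k)) \<longlonglongrightarrow> \<gamma>"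
      and mem: "\<gamma> \<in> \<Gamma>" "\<eta> \<in> base_at D domV \<gamma>" "\<eta> \<in> B" for T \<eta> \<gamma>
  proof -
    have T0: "\<forall>\<^sub>F k in sequentially. T k \<in> {0..}"
      using T by (simp add: filterlim_at_top)
    have "(\<lambda>k. ?v (T k)) \<longlonglongrightarrow> V (\<eta>, \<gamma>)"
    proof (rule continuous_on_tendsto_compose[OF contB tendsto_Pair[OF lims]])
      show "(\<eta>, \<gamma>) \<in> D \<inter> (B \<times> \<Gamma>)" using mem by (auto simp: base_at_def fiber_def)
      show "\<forall>\<^sub>F k in sequentially. (x (T k), \<sigma> (T k)) \<in> D \<inter> (B \<times> \<Gamma>)"
        using T0 by eventually_elim (intro state_in, simp)
    qed
    then show ?thesis
      using tendsto_Inf_antimono_on[OF mono bdd T T0] LIMSEQ_unique by blast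
  qed
  then have "tends_to_set x (\<Union>\<gamma>\<in>\<Gamma>. \<Union>\<gamma>'\<in>\<Gamma>.
    obs_fwd_at D f domV W \<gamma> \<inter> obs_bwd_at D f domV W \<gamma>' \<inter>
    level_set domV V \<gamma> (Inf (?v ` {0..})) \<inter> level_set domV V \<gamma>' (Inf (?v ` {0..})))"
    by (rule tends_to_level_set[OF V BV])
  then show ?thesis by blast
qed

text \<open>A finite \<Gamma> is discrete, so a signal converging along \<open>T k\<close>
  eventually equals its limit \<gamma>. Continuity in the state for fixed \<gamma> then suffices,
  and the level is the infimum over the times at which \<gamma> is active.\<close>

lemma tends_to_signal_level_sets:
  assumes V: "class_V \<Gamma> D domV V" "decrease_condition \<Gamma> D f domV V W" and BV: "B \<subseteq> base domV"
    and fin: "finite \<Gamma>"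
    and mono: "\<forall>\<gamma>\<in>\<Gamma>. antimono_on (\<sigma> -` {\<gamma>} \<inter> {0..}) (\<lambda>t. V (x t, \<sigma> t))"
  shows "\<exists>c. tends_to_set x (\<Union>\<gamma>\<in>\<Gamma>. \<Union>\<gamma>'\<in>\<Gamma>.
    obs_fwd_at D f domV W \<gamma> \<inter> obs_bwd_at D f domV W \<gamma>' \<inter>
    level_set domV V \<gamma> (c \<gamma>) \<inter> level_set domV V \<gamma>' (c \<gamma>'))"
proof -
  let ?v = "\<lambda>t. V (x t, \<sigma> t)" and ?S = "\<lambda>\<gamma>. \<sigma> -` {\<gamma>} \<inter> {0..}"
  have contV: "isCont (\<lambda>\<xi>. V (\<xi>, \<gamma>)) \<xi>" if "\<gamma> \<in> \<Gamma>" "\<xi> \<in> base_at D domV \<gamma>" for \<gamma> \<xi>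
    by (rule differentiable_imp_continuous_within) (use V(1) that in \<open>simp add: class_V_def\<close>)
  have bdd: "bdd_below (?v ` ?S \<gamma>)" if \<gamma>: "\<gamma> \<in> \<Gamma>" for \<gamma>
  proof -
    \<comment> \<open>All states attained while \<gamma> is active lie in this compact slice, on
      which \<open>V\<close> is continuous because it is differentiable there.\<close>
    have "compact ((\<lambda>\<xi>. (\<xi>, \<gamma>)) -` D \<inter> B)"
      by (intro closed_Int_compact compact_B closed_vimage closed_D continuous_intros)
    moreover have "(\<lambda>\<xi>. (\<xi>, \<gamma>)) -` D \<inter> B \<subseteq> base_at D domV \<gamma>"
      using BV by (auto simp: base_at_def fiber_def)
    then have "continuous_on ((\<lambda>\<xi>. (\<xi>, \<gamma>)) -` D \<inter> B) (\<lambda>\<xi>. V (\<xi>, \<gamma>))"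
      using contV[OF \<gamma>] by (intro continuous_at_imp_continuous_on) blast
    ultimately have "bounded ((\<lambda>\<xi>. V (\<xi>, \<gamma>)) ` ((\<lambda>\<xi>. (\<xi>, \<gamma>)) -` D \<inter> B))"
      by (intro compact_imp_bounded compact_continuous_image)
    then have "bdd_below ((\<lambda>\<xi>. V (\<xi>, \<gamma>)) ` ((\<lambda>\<xi>. (\<xi>, \<gamma>)) -` D \<inter> B))"
      by (rule bounded_imp_bdd_below)
    moreover have "?v ` ?S \<gamma> \<subseteq> (\<lambda>\<xi>. V (\<xi>, \<gamma>)) ` ((\<lambda>\<xi>. (\<xi>, \<gamma>)) -` D \<inter> B)"
      using x_in_B x_in_D by auto
    ultimately show ?thesis
      by (rule bdd_below_mono)
  qed
  have "V (\<eta>, \<gamma>) = Inf (?v ` ?S \<gamma>)"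
    if T: "filterlim T at_top sequentially" and lims: "(\<lambda>k. x (T k)) \<longlonglongrightarrow> \<eta>" "(\<lambda>k. \<sigma> (T k)) \<longlonglongrightarrow> \<gamma>"
      and mem: "\<gamma> \<in> \<Gamma>" "\<eta> \<in> base_at D domV \<gamma>" "\<eta> \<in> B" for T \<eta> \<gamma>
  proof -
    have "open (- (\<Gamma> - {\<gamma>}))" using fin by (intro open_Compl finite_imp_closed) simp
    then have "\<forall>\<^sub>F k in sequentially. \<sigma> (T k) \<in> - (\<Gamma> - {\<gamma>})"
      using topological_tendstoD[OF lims(2)] by blast
    then have ev: "\<forall>\<^sub>F k in sequentially. \<sigma> (T k) = \<gamma>"
      by eventually_elim (use signal_in in blast)
    moreover have "\<forall>\<^sub>F k in sequentially. 0 \<le> T k"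
      using T by (simp add: filterlim_at_top)
    ultimately have TS: "\<forall>\<^sub>F k in sequentially. T k \<in> ?S \<gamma>"
      by eventually_elim simp
    have "(\<lambda>k. V (x (T k), \<gamma>)) \<longlonglongrightarrow> V (\<eta>, \<gamma>)"
      by (rule isCont_tendsto_compose[OF contV[OF mem(1,2)] lims(1)])
    then have "(\<lambda>k. ?v (T k)) \<longlonglongrightarrow> V (\<eta>, \<gamma>)"
      by (rule Lim_transform_eventually) (use ev in \<open>auto elim: eventually_mono\<close>)
    then show ?thesis
      using tendsto_Inf_antimono_on[OF _ bdd[OF mem(1)] T TS] mono mem(1) LIMSEQ_unique by blast
  qed
  then have "tends_to_set x (\<Union>\<gamma>\<in>\<Gamma>. \<Union>\<gamma>'\<in>\<Gamma>.
    obs_fwd_at D f domV W \<gamma> \<inter> obs_bwd_at D f domV W \<gamma>' \<inter>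
    level_set domV V \<gamma> (Inf (?v ` ?S \<gamma>)) \<inter> level_set domV V \<gamma>' (Inf (?v ` ?S \<gamma>')))"
    by (rule tends_to_level_set[OF V BV])
  \<comment> \<open>For a parameter never active after time 0 this is the infimum of the empty set;
    no joint limit carries such a parameter.\<close>
  then show ?thesis by (intro exI[of _ "\<lambda>\<gamma>. Inf (?v ` ?S \<gamma>)"])
qed

text \<open>Without continuity, values of \<open>V\<close> along the trajectory say nothing about
  those along a limit arc. The contradiction is sought on the trajectory itself, to which continuity
  of \<open>W\<close> transfers a positive dissipation rate.\<close>

lemma tends_to_zero_dissipation_set:
  assumes V: "class_V \<Gamma> D domV V" "decrease_condition \<Gamma> D f domV V W" and BV: "B \<subseteq> base domV"
    and bounded: "bounded (V ` (D \<inter> (B \<times> \<Gamma>)))"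
    and mono: "antimono_on {0..} (\<lambda>t. V (x t, \<sigma> t))"
    and contW: "continuous_on (D \<inter> (base domV \<times> \<Gamma>)) (\<lambda>(\<xi>, \<gamma>). W \<gamma> \<xi>)"
  shows "tends_to_set x (\<Union>\<gamma>\<in>\<Gamma>. \<Union>\<gamma>'\<in>\<Gamma>. obs_fwd_at D f domV W \<gamma> \<inter> obs_bwd_at D f domV W \<gamma>')"
proof -
  let ?v = "\<lambda>t. V (x t, \<sigma> t)"
  have contW': "continuous_on (D \<inter> (B \<times> \<Gamma>)) (\<lambda>(\<xi>, \<gamma>). W \<gamma> \<xi>)"
    using contW D_B_subset[OF BV] by (rule continuous_on_subset)
  have state_base: "x t \<in> base_at D domV (\<sigma> t)" if "t \<ge> 0" for t
    using state_in[OF that] BV by (auto simp: base_at_def fiber_def)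
  have inner: "W \<gamma> (\<phi> t) = 0" if arc: "limit_arc T a b \<gamma> \<phi>" and t: "t \<in> {a<..<b}" for T a b \<gamma> \<phi> t
  proof (rule ccontr)
    assume "W \<gamma> (\<phi> t) \<noteq> 0"
    have t': "t \<in> {a..b}" using t by simp
    note \<gamma> = limit_arcD(2)[OF arc] and T = limit_arcD(3)[OF arc]
    define w where "w = W \<gamma> (\<phi> t)"
    have w: "w > 0"
      using decrease_condition_nonneg[OF V(2) \<gamma> limit_arc_base_at[OF arc BV t']]
        \<open>W \<gamma> (\<phi> t) \<noteq> 0\<close> by (simp add: w_def)
    have limit_in: "(\<phi> t, \<gamma>) \<in> D \<inter> (B \<times> \<Gamma>)"
      using limit_arcD(5,6)[OF arc t'] \<gamma> by simp
    obtain \<eta> where \<eta>: "\<eta> > 0" "\<And>z g. (z, g) \<in> D \<inter> (B \<times> \<Gamma>) \<Longrightarrow> dist (z, g) (\<phi> t, \<gamma>) < \<eta> \<Longrightarrow> w / 2 < W g z"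
    proof -
      obtain \<eta> where \<eta>: "\<eta> > 0" "\<forall>p\<in>D \<inter> (B \<times> \<Gamma>). dist p (\<phi> t, \<gamma>) < \<eta> \<longrightarrow>
          dist (case p of (\<xi>, \<gamma>) \<Rightarrow> W \<gamma> \<xi>) (case (\<phi> t, \<gamma>) of (\<xi>, \<gamma>) \<Rightarrow> W \<gamma> \<xi>) < w / 2"
        using contW'[unfolded continuous_on_iff, rule_format, OF limit_in, of "w / 2"] w by auto
      show thesis
      proof (rule that[OF \<eta>(1)])
        fix z g assume "(z, g) \<in> D \<inter> (B \<times> \<Gamma>)" "dist (z, g) (\<phi> t, \<gamma>) < \<eta>"
        then have "dist (W g z) w < w / 2" using \<eta>(2) by (fastforce simp: w_def)
        then show "w / 2 < W g z" unfolding dist_real_def by linarith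
      qed
    qed
    obtain M where lip: "M-lipschitz_on {0..} x" by (rule x_lipschitz)
    then have M: "M \<ge> 0" by (rule lipschitz_on_nonneg)
    \<comment> \<open>The first bound keeps \<open>x\<close> within \<eta> / 4 of its value at
      \<open>T k + t\<close> for times at distance at most \<rho>; the others keep
      \<open>{t - \<rho>..t + \<rho>}\<close> inside the open interval, where the signal is
      eventually constant.\<close>
    define \<rho> where "\<rho> = min (\<eta> / (4 * (M + 1))) (min ((t - a) / 2) ((b - t) / 2))"
    have "\<rho> \<le> (t - a) / 2" "\<rho> \<le> (b - t) / 2" unfolding \<rho>_def by linarith+
    then have \<rho>: "\<rho> > 0" "a < t - \<rho>" "t + \<rho> < b"
      using \<eta>(1) M t by (auto simp: \<rho>_def add_nonneg_pos)
    have "M * \<rho> \<le> M * (\<eta> / (4 * (M + 1)))"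
      using M by (intro mult_left_mono) (auto simp: \<rho>_def)
    also have "\<dots> < \<eta> / 4" using M \<eta>(1) by (simp add: field_simps)
    finally have M\<rho>: "M * \<rho> < \<eta> / 4" .
    have shift: "filterlim (\<lambda>k. T k + s) at_top sequentially" for s
      using T by (rule filterlim_at_top_add_const)
    have T0: "\<forall>\<^sub>F k in sequentially. T k \<in> {0..}" if "filterlim T at_top sequentially" for T :: "nat \<Rightarrow> real"
      using that by (simp add: filterlim_at_top)
    \<comment> \<open>Both values converge to the infimum of \<open>v\<close>, so their difference
      falls below \<open>\<rho> * w\<close>, the drop that rate \<open>w / 2\<close> forces over
      time \<open>2 * \<rho>\<close>.\<close>
    have "(\<lambda>k. ?v (T k + (t - \<rho>)) - ?v (T k + (t + \<rho>))) \<longlonglongrightarrow> Inf (?v ` {0..}) - Inf (?v ` {0..})"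
      by (intro tendsto_diff tendsto_Inf_antimono_on[OF mono bdd_below_along[OF bounded]] shift T0)
    then have "\<forall>\<^sub>F k in sequentially. ?v (T k + (t - \<rho>)) - ?v (T k + (t + \<rho>)) < \<rho> * w"
      using \<rho>(1) w by (intro order_tendstoD(2)) auto
    moreover have "\<forall>\<^sub>F k in sequentially. dist (x (T k + t)) (\<phi> t) < \<eta> / 4"
      using \<eta>(1) by (intro tendstoD[OF limit_arcD(8)[OF arc t']]) simp
    moreover have "\<forall>\<^sub>F k in sequentially. dist (\<sigma> (T k + t)) \<gamma> < \<eta> / 2"
      using \<eta>(1) by (intro tendstoD[OF limit_arcD(9)[OF arc t]]) simp
    moreover have "\<forall>\<^sub>F k in sequentially. \<sigma> constant_on {T k + (t - \<rho>)..T k + (t + \<rho>)}"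
      using \<rho> by (intro limit_arcD(10)[OF arc])
    moreover have "\<forall>\<^sub>F k in sequentially. T k + (t - \<rho>) \<in> {0..}" using shift by (rule T0)
    ultimately have "\<forall>\<^sub>F k in sequentially. False"
    proof eventually_elim
      case (elim k)
      \<comment> \<open>The active value \<open>g\<close> is only close to \<gamma> and may differ
        from it, which is why the lower bound on \<open>W\<close> was taken jointly in state and
        parameter.\<close>
      define p q g where "p = T k + (t - \<rho>)" and "q = T k + (t + \<rho>)" and "g = \<sigma> (T k + t)"
      have pq: "0 \<le> p" "p < q" "q - p = 2 * \<rho>" "T k + t \<in> {p..q}"
        using elim(5) \<rho>(1) by (auto simp: p_def q_def)
      have \<sigma>g: "\<sigma> s = g" if "s \<in> {p..q}" for s
        using constant_onD[OF elim(4), of s "T k + t"] that pq(4) by (simp add: p_def q_def g_def)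
      have "\<exists>d. ((\<lambda>s. V (x s, g)) has_real_derivative d) (at s within {p..q}) \<and> d \<le> - (w / 2)"
        if s: "s \<in> {p..q}" for s
      proof -
        have s0: "s \<ge> 0" using s pq(1) by simp
        have "dist (x s) (x (T k + t)) \<le> M * dist s (T k + t)"
          using s pq by (intro lipschitz_onD[OF lip]) auto
        also have "\<dots> \<le> M * \<rho>"
          using s M by (intro mult_left_mono) (auto simp: p_def q_def dist_real_def)
        finally have "dist (x s) (x (T k + t)) < \<eta> / 4" using M\<rho> by simp
        then have "dist (x s) (\<phi> t) < \<eta> / 2"
          using elim(2) dist_triangle[of "x s" "\<phi> t" "x (T k + t)"] by simp
        then have "dist (x s, g) (\<phi> t, \<gamma>) < \<eta>"
          using elim(3) by (intro dist_Pair_less) (simp_all add: g_def)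
        then have "w / 2 < W g (x s)"
          using state_in[OF s0] \<sigma>g[OF s] by (intro \<eta>(2)) auto
        moreover have "\<exists>d. ((\<lambda>s. V (x s, g)) has_real_derivative d) (at s within {p..q}) \<and> d \<le> - W g (x s)"
          using state_base[OF s0] \<sigma>g[OF s] signal_in[of s]
          by (intro derivative_along_solution_le[OF V] has_vector_derivative_between_jumps[OF pq(1,2) \<sigma>g s]) auto
        ultimately show ?thesis by force
      qed
      then obtain d where d: "\<And>s. s \<in> {p..q} \<Longrightarrow>
          ((\<lambda>s. V (x s, g)) has_real_derivative d s) (at s within {p..q}) \<and> d s \<le> - (w / 2)"
        by metis
      obtain s where s: "s \<in> {p<..<q}" "V (x q, g) - V (x p, g) = d s * (q - p)"
        using mvt_simple[OF pq(2), of "\<lambda>s. V (x s, g)" "\<lambda>s. (*) (d s)"] d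
        by (auto simp: has_field_derivative_def)
      have "d s * (q - p) \<le> - (w / 2) * (q - p)"
        using d[of s] s(1) pq(2) by (intro mult_right_mono) auto
      then have "\<rho> * w \<le> V (x p, g) - V (x q, g)"
        using s(2) pq(3) by (simp add: algebra_simps)
      then show False
        using elim(1) \<sigma>g[of p] \<sigma>g[of q] pq(2) by (simp add: p_def[symmetric] q_def[symmetric])
    qed
    then show False by simp
  qed
  have "tends_to_set x (\<Union>\<gamma>\<in>\<Gamma>. \<Union>\<gamma>'\<in>\<Gamma>.
    obs_fwd_at D f domV W \<gamma> \<inter> obs_bwd_at D f domV W \<gamma>' \<inter> UNIV \<inter> UNIV)"
  proof (rule tends_to_observability_set[OF BV])
    fix T a b \<gamma> \<phi> t assume arc: "limit_arc T a b \<gamma> \<phi>" and t: "t \<in> {a..b}"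
    obtain M where "M-lipschitz_on {a..b} \<phi>" using limit_arcD(4)[OF arc] by blast
    then have "continuous_on {a..b} \<phi>" by (rule lipschitz_on_continuous_on)
    \<comment> \<open>Continuity of \<open>W\<close> along the arc extends its vanishing from
      interior times to the endpoints.\<close>
    then have "continuous_on {a..b} (\<lambda>t. case (\<phi> t, \<gamma>) of (\<xi>, \<gamma>) \<Rightarrow> W \<gamma> \<xi>)"
      using limit_arcD(2,5,6)[OF arc]
      by (intro continuous_on_compose2[OF contW'] continuous_intros) auto
    then show "W \<gamma> (\<phi> t) = 0 \<and> \<phi> t \<in> UNIV"
      using continuous_constant_on_closure[of "{a<..<b}" "\<lambda>t. W \<gamma> (\<phi> t)" 0 t]
        inner[OF arc] limit_arcD(1)[OF arc] t by auto
  qed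
  then show ?thesis by simp
qed

end

section \<open>Application to the given trajectory\<close>

lemma trajectory_precompact_trajectory:
  assumes "compact \<Gamma>" "closed domf" "continuous_on domf f" "trajectory \<Gamma> domf f I x \<sigma>"
    "{0..} \<subseteq> I" "\<sigma> \<in> signals_avg_dwell \<Gamma>" "precompact_rel I x S"
  obtains B where "B \<subseteq> S" "precompact_trajectory \<Gamma> domf f x \<sigma> B"
proof -
  obtain B where B: "compact B" "B \<subseteq> S" "\<And>t. t \<in> I \<Longrightarrow> x t \<in> B"
    using assms(7) unfolding precompact_rel_def by blast
  have sol: "solution_on I (\<lambda>t. fiber domf (\<sigma> t)) (\<lambda>t \<xi>. f (\<xi>, \<sigma> t)) x"
    using assms(4) by (simp add: trajectory_def)
  have "precompact_trajectory \<Gamma> domf f x \<sigma> B"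
  proof
    show "increments_controlled {0..} x (\<lambda>t. f (x t, \<sigma> t))"
      using increments_controlled_subset[OF solution_on_increments_controlled[OF sol] assms(5)] .
    fix t :: real assume "t \<ge> 0"
    then have "t \<in> I" using assms(5) by auto
    then show "x t \<in> B" "(x t, \<sigma> t) \<in> domf"
      using B(3) sol by (auto simp: solution_on_def fiber_def)
  qed (use assms B in auto)
  then show ?thesis using that B(2) by blast
qed

theorem theorem4p1:
  fixes \<Gamma> :: "'g::metric_space set"
    and domf :: "((real ^ 'n) \<times> 'g) set"
    and f :: "(real ^ 'n) \<times> 'g \<Rightarrow> real ^ 'n"
    and I :: "real set"
    and x :: "real \<Rightarrow> real ^ 'n"
    and \<sigma> :: "real \<Rightarrow> 'g"
  assumes "compact \<Gamma>"
    and "domf \<subseteq> UNIV \<times> \<Gamma>"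
    and "closed domf"
    and "continuous_on domf f"
    and "trajectory \<Gamma> domf f I x \<sigma>"
    and "{0..} \<subseteq> I"
    and "\<sigma> \<in> signals_avg_dwell \<Gamma>"
  shows
    "(\<forall>domV (V :: (real ^ 'n) \<times> 'g \<Rightarrow> real) (W :: 'g \<Rightarrow> real ^ 'n \<Rightarrow> real).
        class_V \<Gamma> domf domV V \<and>
        continuous_on (domf \<inter> (base domV \<times> \<Gamma>)) V \<and>
        precompact_rel I x (base domV) \<and>
        antimono_on {0..} (\<lambda>t. V (x t, \<sigma> t)) \<and>
        decrease_condition \<Gamma> domf f domV V W
        \<longrightarrow> (\<exists>c. tends_to_set x
               (\<Union>\<gamma>\<in>\<Gamma>. \<Union>\<gamma>'\<in>\<Gamma>.
                  obs_fwd_at domf f domV W \<gamma> \<inter> obs_bwd_at domf f domV W \<gamma>' \<inter>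
                  level_set domV V \<gamma> c \<inter> level_set domV V \<gamma>' c)))
     \<and>
     (\<forall>domV (V :: (real ^ 'n) \<times> 'g \<Rightarrow> real) (W :: 'g \<Rightarrow> real ^ 'n \<Rightarrow> real).
        class_V \<Gamma> domf domV V \<and>
        (\<forall>K. compact K \<and> K \<subseteq> domf \<inter> (base domV \<times> \<Gamma>) \<longrightarrow> bounded (V ` K)) \<and>
        precompact_rel I x (base domV) \<and>
        antimono_on {0..} (\<lambda>t. V (x t, \<sigma> t)) \<and>
        decrease_condition \<Gamma> domf f domV V W \<and>
        continuous_on (domf \<inter> (base domV \<times> \<Gamma>)) (\<lambda>(\<xi>, \<gamma>). W \<gamma> \<xi>)
        \<longrightarrow> tends_to_set x
              (\<Union>\<gamma>\<in>\<Gamma>. \<Union>\<gamma>'\<in>\<Gamma>. obs_fwd_at domf f domV W \<gamma> \<inter> obs_bwd_at domf f domV W \<gamma>'))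
     \<and>
     (finite \<Gamma> \<longrightarrow>
      (\<forall>domV (V :: (real ^ 'n) \<times> 'g \<Rightarrow> real) (W :: 'g \<Rightarrow> real ^ 'n \<Rightarrow> real).
        class_V \<Gamma> domf domV V \<and>
        precompact_rel I x (base domV) \<and>
        (\<forall>\<gamma>\<in>\<Gamma>. antimono_on (\<sigma> -` {\<gamma>} \<inter> {0..}) (\<lambda>t. V (x t, \<sigma> t))) \<and>
        decrease_condition \<Gamma> domf f domV V W
        \<longrightarrow> (\<exists>c :: 'g \<Rightarrow> real. tends_to_set x
               (\<Union>\<gamma>\<in>\<Gamma>. \<Union>\<gamma>'\<in>\<Gamma>.
                  obs_fwd_at domf f domV W \<gamma> \<inter> obs_bwd_at domf f domV W \<gamma>' \<inter>
                  level_set domV V \<gamma> (c \<gamma>) \<inter> level_set domV V \<gamma>' (c \<gamma>')))))"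
proof (intro conjI allI impI; elim conjE)
  note traj = trajectory_precompact_trajectory[OF assms(1,3-7)]
  fix domV and V :: "(real ^ 'n) \<times> 'g \<Rightarrow> real" and W :: "'g \<Rightarrow> real ^ 'n \<Rightarrow> real"
  assume "precompact_rel I x (base domV)" "class_V \<Gamma> domf domV V" "decrease_condition \<Gamma> domf f domV V W"
  note V = this(2,3)
  \<comment> \<open>The three claims share this compact set and the resulting locale instance; each
    block below adds its own regularity and monotonicity assumptions.\<close>
  obtain B where B: "B \<subseteq> base domV" and "precompact_trajectory \<Gamma> domf f x \<sigma> B"
    using traj[OF \<open>precompact_rel I x (base domV)\<close>] .
  then interpret precompact_trajectory \<Gamma> domf f x \<sigma> B by simp
  {
    assume "continuous_on (domf \<inter> (base domV \<times> \<Gamma>)) V" "antimono_on {0..} (\<lambda>t. V (x t, \<sigma> t))"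
    then show "\<exists>c. tends_to_set x (\<Union>\<gamma>\<in>\<Gamma>. \<Union>\<gamma>'\<in>\<Gamma>.
        obs_fwd_at domf f domV W \<gamma> \<inter> obs_bwd_at domf f domV W \<gamma>' \<inter>
        level_set domV V \<gamma> c \<inter> level_set domV V \<gamma>' c)"
      by (rule tends_to_common_level_set[OF V B])
  next
    assume "\<forall>K. compact K \<and> K \<subseteq> domf \<inter> (base domV \<times> \<Gamma>) \<longrightarrow> bounded (V ` K)"
    then have "bounded (V ` (domf \<inter> (B \<times> \<Gamma>)))"
      using compact_D_B D_B_subset[OF B] by blast
    moreover assume "antimono_on {0..} (\<lambda>t. V (x t, \<sigma> t))"
      "continuous_on (domf \<inter> (base domV \<times> \<Gamma>)) (\<lambda>(\<xi>, \<gamma>). W \<gamma> \<xi>)"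
    ultimately show "tends_to_set x
        (\<Union>\<gamma>\<in>\<Gamma>. \<Union>\<gamma>'\<in>\<Gamma>. obs_fwd_at domf f domV W \<gamma> \<inter> obs_bwd_at domf f domV W \<gamma>')"
      by (rule tends_to_zero_dissipation_set[OF V B])
  next
    assume "finite \<Gamma>" "\<forall>\<gamma>\<in>\<Gamma>. antimono_on (\<sigma> -` {\<gamma>} \<inter> {0..}) (\<lambda>t. V (x t, \<sigma> t))"
    then show "\<exists>c. tends_to_set x (\<Union>\<gamma>\<in>\<Gamma>. \<Union>\<gamma>'\<in>\<Gamma>.
        obs_fwd_at domf f domV W \<gamma> \<inter> obs_bwd_at domf f domV W \<gamma>' \<inter>
        level_set domV V \<gamma> (c \<gamma>) \<inter> level_set domV V \<gamma>' (c \<gamma>'))"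
      by (rule tends_to_signal_level_sets[OF V B])
  }
qed

end
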